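(* Consider the Midas-LL1 algorithm for the regularized rank-$(L_r,L_r,1)$ block-term decomposition problem, with all objects as defined in the context. Assume that Assumption (A) of the context holds and that the stochastic gradients $\tilde\nabla_{A_{n,r}}f$, $n=1,2,3$, are variance-reduced in the sense of the context. Let $\{A_1^k,A_2^k,A_3^k\}_{k\in\mathbb N}$ be a sequence generated by the algorithm, define the Lyapunov sequence $$\Psi_k:=\Phi(A^k)+\sum_{i=1}^{t+1}\sum_{j=i}^{t+1}(j+1)\bar a_j\|A^{k+1-i}-A^{k-i}\|_F^2+\frac1{2\tau\gamma}\Gamma_k ,$$ and choose $\eta^k$, $\gamma$, $\{\alpha^{k+1-i}\}_{k\ge0}$ and $\{\beta^{k+1-i}\}_{k\ge0}$ such that $$\delta=\underline b-\sum_{j=1}^{t+1}(j+1)\bar a_j>0\qquad\text{and}\qquad (t+2)\bar a_{t+1}-\frac{\gamma}{2}>0 .$$ Then for all $k\in\mathbb N$, $$\mathbb E_k[\Psi_{k+1}]\le\Psi_k-\rho\Big(\mathbb E_k\big[\|A^{k+1}-A^k\|_F^2\big]+\sum_{i=1}^{t+1}\|A^{k+1-i}-A^{k-i}\|_F^2\Big),$$ where $\rho:=\min\{\delta,\,(t+2)\bar a_{t+1}-\frac\gamma2,\,\bar a\}$ and $\bar a=\min_{1\le i\le t}\bar a_i$.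
   Context: **Problem.** Let $\mathcal X\in\mathbb R^{I_1\times I_2\times I_3}$, $R\ge1$, and positive integers $L_1,\dots,L_R$. The variable is $A=(A_1,A_2,A_3)$ with $A_n=[A_{n,1},\dots,A_{n,R}]$, where $A_{n,r}\in\mathbb R^{I_n\times L_r}$ for $n=1,2$ and $A_{3,r}\in\mathbb R^{I_3}$. Put $$f(A)=\frac{1}{2I_1I_2I_3}\Big\|\mathcal X-\sum_{r=1}^R (A_{1,r}A_{2,r}^\top)\circ A_{3,r}\Big\|_F^2,\qquad \Phi(A)=f(A)+\sum_{n=1}^3h_n(A_n),$$ where $\circ$ is the outer product and $h_n(A_n)=\sum_{r=1}^R h_n(A_{n,r})$ (same symbol for the pieces). $\|A\|_F^2=\sum_n\|A_n\|_F^2$. **Algorithm (Midas-LL1).** Given an integer $t\ge1$, stepsizes $\eta^k$, inertial parameters $\alpha^{k+1-i},\beta^{k+1-i}\in[0,1]$, a sample size $B$, and an initial point $A^0$ with $A^{-1}=A^0$ (earlier iterates, where they occur, also equal $A^0$). For $k=0,1,\dots$: sample $n=\xi^k$ uniformly from $\{1,2,3\}$; sample uniformly a set $\mathcal F_n$ of $B$ fiber indices from $\{1,\dots,\prod_{m\ne n}I_m\}$; set $$\tilde A_n^k=A_n^k+\sum_{i=1}^t\alpha^{k+1-i}(A_n^{k+1-i}-A_n^{k-i}),\qquad \underline A_n^k=A_n^k+\sum_{i=1}^t\beta^{k+1-i}(A_n^{k+1-i}-A_n^{k-i});$$ compute with this minibatch a stochastic gradient $\tilde\nabla_{A_n}f(\underline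 A_n^k)$ (column blocks $\tilde\nabla_{A_{n,r}}f(\underline A_n^k)$), where $f(\underline A_n^k)$ means $f$ evaluated with block $n$ equal to $\underline A_n^k$ and the other blocks equal to $A_{n'}^k$; for $r=1,\dots,R$ set $$A_{n,r}^{k+1}=\arg\min_{Z}\; h_n(Z)+\langle\tilde\nabla_{A_{n,r}}f(\underline A_n^k),Z-\tilde A_{n,r}^k\rangle+\frac1{2\eta^k}\|Z-\tilde A_{n,r}^k\|_F^2,$$ and $A_{n'}^{k+1}=A_{n'}^k$ for $n'\ne n$. Write $A^k=(A_1^k,A_2^k,A_3^k)$. **Expectations.** $\xi^k$ and $\zeta^k$ are the stochastic parameters for the block index and for the stochastic gradient at iteration $k$. $\mathbb E_k[\cdot]$ is the conditional expectation at iteration $k$, written $\mathbb E[\cdot\,|\,\xi^k,\zeta^k]$, and $\mathbb E[\cdot]$ is the full expectation, written $\mathbb E[\cdot\,|\,\xi^0,\zeta^0,\dots]$. **Assumption (A).** (i) The $h_n$ are proper, lower semicontinuous, bounded from below, and convex. (ii) The sequence $\{A_1^k,A_2^k,A_3^k\}$ generated by the algorithm is bounded for all $k$. By (ii) there is a constant $L$ such that for every mode $n$ and all $Y,Z$ in place of block $n$ (other blocks fixed at the iterates), $\|\nabla_{A_n}f(\dots,Y,\dots)-\nabla_{A_n}f(\dots,Z,\dots)\|_F\le L\|Y-Z\|_F$; this $L$ is used below. **Variance-reduced estimator.** There are constants $V_1,V_2,V_\Gamma\ge0$, $\tau\in(0,1]$ and random variables $\{\Gamma_k\}_{k\ge1}$,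 $\{\Upsilon_k\}_{k\ge1}$ such that: (i) $\mathbb E_k\|\tilde\nabla_{A_{\xi^k}}f(\underline A_{\xi^k}^k)-\nabla_{A_{\xi^k}}f(\underline A_{\xi^k}^k)\|_F^2\le\Gamma_k+V_1\sum_{i=1}^{t+1}\|A^{k+1-i}-A^{k-i}\|_F^2$ and $\mathbb E_k\|\tilde\nabla_{A_{\xi^k}}f(\underline A_{\xi^k}^k)-\nabla_{A_{\xi^k}}f(\underline A_{\xi^k}^k)\|_F\le\Upsilon_k+V_2\sum_{i=1}^{t+1}\|A^{k+1-i}-A^{k-i}\|_F$; (ii) $\mathbb E_k[\Gamma_{k+1}]\le(1-\tau)\Gamma_k+V_\Gamma\sum_{i=1}^{t+1}\|A^{k+1-i}-A^{k-i}\|_F^2$; (iii) if $\lim_{k\to\infty}\mathbb E\|A^k-A^{k-1}\|_F^2=0$, then $\mathbb E\Gamma_k\to0$ and $\mathbb E\Upsilon_k\to0$. **Parameters.** $\gamma=\sqrt{V_\Gamma/\tau+V_1}$, $$b_k=\frac{1-\sum_{i=1}^t\alpha^{k+1-i}-2L\eta^k-\gamma\eta^k}{2\eta^k},\quad \underline b=\liminf_{k\in\mathbb N} b_k,\qquad a_{k,i}=\frac{3Lt(\beta^{k+1-i})^2}{2}+\frac\gamma2+\frac{\alpha^{k+1-i}}{2\eta^k},\quad \bar a_i=\limsup_{k\in\mathbb N} a_{k,i}.$$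
   Formalization: The lower limit of b_k and the upper limits of a_{k,i} are replaced by the infimum and supremum over all k; with tail limits the inequality can fail at early iterations, e.g. after one very large first stepsize. *)

theory Defs
  imports "HOL-Probability.Probability"
begin

section \<open>The block-term decomposition problem\<close>

text \<open>
  The dimensions are types: the rows of factor \<open>n\<close> are indexed by \<open>'i1\<close>, \<open>'i2\<close>, \<open>'i3\<close>, and
  \<open>R = CARD('r)\<close>. The column blocks have different widths, so all columns of the first two factors
  are indexed by one type \<open>'c\<close>, and a surjection \<open>q :: 'c \<Rightarrow> 'r\<close> tells to which block a column
  belongs, i.e. \<open>L_r = card (q -` {r})\<close>. The third factor has one column for each \<open>r\<close>.
  The norm and inner product of these types are the Frobenius ones.
\<close>

type_synonym ('c, 'r, 'i1, 'i2, 'i3) factors =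
  "(real ^ 'c ^ 'i1) \<times> (real ^ 'c ^ 'i2) \<times> (real ^ 'r ^ 'i3)"

datatype mode = Mode1 | Mode2 | Mode3

definition cols :: "('c \<Rightarrow> 'r) \<Rightarrow> 'r \<Rightarrow> real ^ 'c ^ 'i \<Rightarrow> real ^ 'c ^ 'i" where
  "cols q r M = (\<chi> i c. if q c = r then M $ i $ c else 0)"

text \<open>
  \<open>block n A\<close> is \<open>A_n\<close> and \<open>piece q n r A\<close> is \<open>A_{n,r}\<close>, both padded with zeros to live in the
  space of all factors. The padding is a linear isometry, so that \<open>piece_space q n r\<close> stands for
  the matrices of size \<open>I_n \<times> L_r\<close> (of size \<open>I_3 \<times> 1\<close> if \<open>n = 3\<close>).
\<close>

fun block :: "mode \<Rightarrow> ('c::finite, 'r::finite, 'i1::finite, 'i2::finite, 'i3::finite) factors \<Rightarrow> ('c, 'r, 'i1, 'i2, 'i3) factors" where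
  "block Mode1 (A1, A2, A3) = (A1, 0, 0)"
| "block Mode2 (A1, A2, A3) = (0, A2, 0)"
| "block Mode3 (A1, A2, A3) = (0, 0, A3)"

fun piece :: "('c::finite \<Rightarrow> 'r::finite) \<Rightarrow> mode \<Rightarrow> 'r
    \<Rightarrow> ('c, 'r, 'i1::finite, 'i2::finite, 'i3::finite) factors
    \<Rightarrow> ('c, 'r, 'i1, 'i2, 'i3) factors" where
  "piece q Mode1 r (A1, A2, A3) = (cols q r A1, 0, 0)"
| "piece q Mode2 r (A1, A2, A3) = (0, cols q r A2, 0)"
| "piece q Mode3 r (A1, A2, A3) = (0, 0, cols id r A3)"

definition piece_space :: "('c::finite \<Rightarrow> 'r::finite) \<Rightarrow> mode \<Rightarrow> 'r
    \<Rightarrow> ('c, 'r, 'i1::finite, 'i2::finite, 'i3::finite) factors set" where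
  "piece_space q n r = range (piece q n r)"

definition replace_block :: "mode \<Rightarrow> ('c::finite, 'r::finite, 'i1::finite, 'i2::finite, 'i3::finite) factors
    \<Rightarrow> ('c, 'r, 'i1, 'i2, 'i3) factors \<Rightarrow> ('c, 'r, 'i1, 'i2, 'i3) factors" where
  "replace_block n A Y = A - block n A + block n Y"

fun btd :: "('c::finite \<Rightarrow> 'r::finite) \<Rightarrow> ('c, 'r, 'i1, 'i2, 'i3) factors \<Rightarrow> real ^ 'i3 ^ 'i2 ^ 'i1" where
  "btd q (A1, A2, A3) =
    (\<chi> i j k. \<Sum>r\<in>UNIV. (cols q r A1 ** transpose (cols q r A2)) $ i $ j * A3 $ k $ r)"

definition fit :: "('c::finite \<Rightarrow> 'r::finite) \<Rightarrow> real ^ 'i3::finite ^ 'i2::finite ^ 'i1::finite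
    \<Rightarrow> ('c, 'r, 'i1, 'i2, 'i3) factors \<Rightarrow> real" where
  "fit q X A = (norm (X - btd q A))\<^sup>2 / (2 * real (CARD('i1) * CARD('i2) * CARD('i3)))"

definition obj :: "('c::finite \<Rightarrow> 'r::finite) \<Rightarrow> real ^ 'i3::finite ^ 'i2::finite ^ 'i1::finite
    \<Rightarrow> (mode \<Rightarrow> 'r \<Rightarrow> ('c, 'r, 'i1, 'i2, 'i3) factors \<Rightarrow> ereal)
    \<Rightarrow> ('c, 'r, 'i1, 'i2, 'i3) factors \<Rightarrow> ereal" where
  "obj q X h A = ereal (fit q X A)
    + (\<Sum>n\<in>{Mode1, Mode2, Mode3}. \<Sum>r\<in>UNIV. h n r (piece q n r A))"

definition grad :: "('a::real_inner \<Rightarrow> real) \<Rightarrow> 'a \<Rightarrow> 'a" where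
  "grad F x = (THE D. GDERIV F x :> D)"

definition block_grad :: "('c::finite \<Rightarrow> 'r::finite) \<Rightarrow> real ^ 'i3::finite ^ 'i2::finite ^ 'i1::finite
    \<Rightarrow> mode \<Rightarrow> ('c, 'r, 'i1, 'i2, 'i3) factors \<Rightarrow> ('c, 'r, 'i1, 'i2, 'i3) factors" where
  "block_grad q X n A = block n (grad (fit q X) A)"

definition proper_lsc_bdd_convex_on :: "'a::real_normed_vector set \<Rightarrow> ('a \<Rightarrow> ereal) \<Rightarrow> bool" where
  "proper_lsc_bdd_convex_on S F \<longleftrightarrow>
    (\<forall>x\<in>S. F x \<noteq> -\<infinity>) \<and> (\<exists>x\<in>S. F x \<noteq> \<infinity>) \<and>
    (\<forall>x\<in>S. F x \<le> Liminf (at x within S) F) \<and>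
    (\<exists>c::real. \<forall>x\<in>S. ereal c \<le> F x) \<and>
    (\<forall>x\<in>S. \<forall>y\<in>S. \<forall>u::real. 0 \<le> u \<and> u \<le> 1 \<longrightarrow>
      F (u *\<^sub>R x + (1 - u) *\<^sub>R y) \<le> ereal u * F x + ereal (1 - u) * F y)"


section \<open>Conditional expectation given the history\<close>

text \<open>
  The analogue of \<open>real_cond_exp\<close> for functions with values in the extended reals, needed because
  the regularizers may take the value \<open>\<infinity>\<close>. As \<open>e2ennreal\<close> maps negative numbers to \<open>0\<close>, the two
  terms are the conditional expectations of the positive and the negative part.
\<close>

definition ereal_cond_exp :: "'w measure \<Rightarrow> 'w measure \<Rightarrow> ('w \<Rightarrow> ereal) \<Rightarrow> 'w \<Rightarrow> ereal" where
  "ereal_cond_exp M F Y \<omega> =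
    enn2ereal (nn_cond_exp M F (\<lambda>\<omega>. e2ennreal (Y \<omega>)) \<omega>)
    - enn2ereal (nn_cond_exp M F (\<lambda>\<omega>. e2ennreal (- Y \<omega>)) \<omega>)"

text \<open>
  The history before iteration \<open>k\<close>, generated by the samples of the iterations \<open>j < k\<close>. The
  expectation \<open>E_k\<close> averages over the samples \<open>\<xi> k\<close>, \<open>\<zeta> k\<close> drawn at iteration \<open>k\<close>, i.e. it
  is the conditional expectation given \<open>history M Z \<xi> \<zeta> k\<close>.
\<close>

definition history :: "'w measure \<Rightarrow> 'z measure \<Rightarrow> (nat \<Rightarrow> 'w \<Rightarrow> mode) \<Rightarrow> (nat \<Rightarrow> 'w \<Rightarrow> 'z)
    \<Rightarrow> nat \<Rightarrow> 'w measure" where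
  "history M Z \<xi> \<zeta> k = sigma (space M)
    (\<Union>j<k. {\<xi> j -` B \<inter> space M | B. B \<in> UNIV} \<union> {\<zeta> j -` B \<inter> space M | B. B \<in> sets Z})"


section \<open>The algorithm\<close>

text \<open>
  Iterates are indexed by \<open>nat\<close>. Truncated subtraction implements the convention that all iterates
  with a negative index equal the initial one: \<open>A (k - i) = A 0\<close> for \<open>i > k\<close>. The inertial
  parameters carry the index \<open>k + 1 - i\<close>, which may be negative and is therefore an integer.
\<close>

definition extrapolate :: "nat \<Rightarrow> (int \<Rightarrow> real) \<Rightarrow> (nat \<Rightarrow> 'a::real_vector) \<Rightarrow> nat \<Rightarrow> 'a" where
  "extrapolate t c A k =
    A k + (\<Sum>i=1..t. c (int k + 1 - int i) *\<^sub>R (A (k + 1 - i) - A (k - i)))"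

fun num_fibers :: "nat \<Rightarrow> nat \<Rightarrow> nat \<Rightarrow> mode \<Rightarrow> nat" where
  "num_fibers I1 I2 I3 Mode1 = I2 * I3"
| "num_fibers I1 I2 I3 Mode2 = I1 * I3"
| "num_fibers I1 I2 I3 Mode3 = I1 * I2"

text \<open>
  The random element \<open>\<zeta> k\<close> contains the minibatch \<open>fib (\<zeta> k)\<close> and possibly further randomness of
  the estimator. The stochastic gradient \<open>G k\<close> may depend on all samples drawn so far (which
  includes estimators with memory); only its block \<open>\<xi> k\<close> is used.
\<close>

definition midas_ll1 ::
  "'w measure \<Rightarrow> 'z measure \<Rightarrow> (nat \<Rightarrow> 'w \<Rightarrow> mode) \<Rightarrow> (nat \<Rightarrow> 'w \<Rightarrow> 'z) \<Rightarrow> ('z \<Rightarrow> nat set) \<Rightarrow> nat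
    \<Rightarrow> ('c::finite \<Rightarrow> 'r::finite)
    \<Rightarrow> (mode \<Rightarrow> 'r \<Rightarrow> ('c, 'r, 'i1::finite, 'i2::finite, 'i3::finite) factors \<Rightarrow> ereal)
    \<Rightarrow> nat \<Rightarrow> (nat \<Rightarrow> real) \<Rightarrow> (int \<Rightarrow> real)
    \<Rightarrow> ('c, 'r, 'i1, 'i2, 'i3) factors
    \<Rightarrow> (nat \<Rightarrow> 'w \<Rightarrow> ('c, 'r, 'i1, 'i2, 'i3) factors)
    \<Rightarrow> (nat \<Rightarrow> 'w \<Rightarrow> ('c, 'r, 'i1, 'i2, 'i3) factors) \<Rightarrow> bool" where
  "midas_ll1 M Z \<xi> \<zeta> fib B q h t \<eta> \<alpha> A0 G A \<longleftrightarrow>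
    (\<forall>k. \<xi> k \<in> M \<rightarrow>\<^sub>M count_space UNIV) \<and>
    (\<forall>k. \<zeta> k \<in> M \<rightarrow>\<^sub>M Z) \<and>
    fib \<in> Z \<rightarrow>\<^sub>M count_space UNIV \<and>
    (\<forall>k n S. S \<subseteq> {1..num_fibers CARD('i1) CARD('i2) CARD('i3) n} \<and> card S = B \<longrightarrow>
      (AE \<omega> in M. real_cond_exp M (history M Z \<xi> \<zeta> k)
          (indicator {\<omega> \<in> space M. \<xi> k \<omega> = n \<and> fib (\<zeta> k \<omega>) = S}) \<omega>
        = 1 / 3 * (1 / real (num_fibers CARD('i1) CARD('i2) CARD('i3) n choose B)))) \<and>
    (\<forall>k. G k \<in> borel_measurable (history M Z \<xi> \<zeta> (Suc k))) \<and>
    (\<forall>\<omega>\<in>space M. A 0 \<omega> = A0) \<and>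
    (\<forall>k. \<forall>\<omega>\<in>space M.
      (\<forall>n. n \<noteq> \<xi> k \<omega> \<longrightarrow> block n (A (Suc k) \<omega>) = block n (A k \<omega>)) \<and>
      (\<forall>r. is_arg_min
        (\<lambda>Y. let D = Y - piece q (\<xi> k \<omega>) r (extrapolate t \<alpha> (\<lambda>j. A j \<omega>) k) in
          h (\<xi> k \<omega>) r Y
          + ereal (piece q (\<xi> k \<omega>) r (G k \<omega>) \<bullet> D + 1 / (2 * \<eta> k) * (norm D)\<^sup>2))
        (\<lambda>Y. Y \<in> piece_space q (\<xi> k \<omega>) r)
        (piece q (\<xi> k \<omega>) r (A (Suc k) \<omega>))))"

definition grad_error ::
  "(nat \<Rightarrow> 'w \<Rightarrow> mode) \<Rightarrow> ('c::finite \<Rightarrow> 'r::finite) \<Rightarrow> real ^ 'i3::finite ^ 'i2::finite ^ 'i1::finite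
    \<Rightarrow> nat \<Rightarrow> (int \<Rightarrow> real)
    \<Rightarrow> (nat \<Rightarrow> 'w \<Rightarrow> ('c, 'r, 'i1, 'i2, 'i3) factors)
    \<Rightarrow> (nat \<Rightarrow> 'w \<Rightarrow> ('c, 'r, 'i1, 'i2, 'i3) factors) \<Rightarrow> nat \<Rightarrow> 'w \<Rightarrow> real" where
  "grad_error \<xi> q X t \<beta> G A k \<omega> =
    norm (block (\<xi> k \<omega>) (G k \<omega>)
      - block_grad q X (\<xi> k \<omega>)
          (replace_block (\<xi> k \<omega>) (A k \<omega>) (extrapolate t \<beta> (\<lambda>j. A j \<omega>) k)))"

definition variance_reduced ::
  "'w measure \<Rightarrow> 'z measure \<Rightarrow> (nat \<Rightarrow> 'w \<Rightarrow> mode) \<Rightarrow> (nat \<Rightarrow> 'w \<Rightarrow> 'z)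
    \<Rightarrow> ('c::finite \<Rightarrow> 'r::finite) \<Rightarrow> real ^ 'i3::finite ^ 'i2::finite ^ 'i1::finite
    \<Rightarrow> nat \<Rightarrow> (int \<Rightarrow> real)
    \<Rightarrow> (nat \<Rightarrow> 'w \<Rightarrow> ('c, 'r, 'i1, 'i2, 'i3) factors)
    \<Rightarrow> (nat \<Rightarrow> 'w \<Rightarrow> ('c, 'r, 'i1, 'i2, 'i3) factors)
    \<Rightarrow> real \<Rightarrow> real \<Rightarrow> real \<Rightarrow> real \<Rightarrow> (nat \<Rightarrow> 'w \<Rightarrow> real) \<Rightarrow> (nat \<Rightarrow> 'w \<Rightarrow> real) \<Rightarrow> bool" where
  "variance_reduced M Z \<xi> \<zeta> q X t \<beta> G A V1 V2 V\<Gamma> \<tau> \<Gamma> \<Upsilon> \<longleftrightarrow>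
    0 \<le> V1 \<and> 0 \<le> V2 \<and> 0 \<le> V\<Gamma> \<and> 0 < \<tau> \<and> \<tau> \<le> 1 \<and>
    (\<forall>k. integrable M (\<Gamma> k)) \<and> (\<forall>k. integrable M (\<Upsilon> k)) \<and>
    (\<forall>k. AE \<omega> in M.
      ereal_cond_exp M (history M Z \<xi> \<zeta> k) (\<lambda>\<omega>. ereal ((grad_error \<xi> q X t \<beta> G A k \<omega>)\<^sup>2)) \<omega>
      \<le> ereal (\<Gamma> k \<omega> + V1 * (\<Sum>i=1..t+1. (norm (A (k + 1 - i) \<omega> - A (k - i) \<omega>))\<^sup>2))) \<and>
    (\<forall>k. AE \<omega> in M.
      ereal_cond_exp M (history M Z \<xi> \<zeta> k) (\<lambda>\<omega>. ereal (grad_error \<xi> q X t \<beta> G A k \<omega>)) \<omega>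
      \<le> ereal (\<Upsilon> k \<omega> + V2 * (\<Sum>i=1..t+1. norm (A (k + 1 - i) \<omega> - A (k - i) \<omega>)))) \<and>
    (\<forall>k. AE \<omega> in M.
      ereal_cond_exp M (history M Z \<xi> \<zeta> k) (\<lambda>\<omega>. ereal (\<Gamma> (k + 1) \<omega>)) \<omega>
      \<le> ereal ((1 - \<tau>) * \<Gamma> k \<omega>
          + V\<Gamma> * (\<Sum>i=1..t+1. (norm (A (k + 1 - i) \<omega> - A (k - i) \<omega>))\<^sup>2))) \<and>
    ((\<lambda>k. \<integral>\<omega>. (norm (A k \<omega> - A (k - 1) \<omega>))\<^sup>2 \<partial>M) \<longlonglongrightarrow> 0 \<longrightarrow>
      (\<lambda>k. \<integral>\<omega>. \<Gamma> k \<omega> \<partial>M) \<longlonglongrightarrow> 0 \<and> (\<lambda>k. \<integral>\<omega>. \<Upsilon> k \<omega> \<partial>M) \<longlonglongrightarrow> 0)"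


section \<open>Parameters and the Lyapunov sequence\<close>

definition b_seq :: "nat \<Rightarrow> (nat \<Rightarrow> real) \<Rightarrow> (int \<Rightarrow> real) \<Rightarrow> real \<Rightarrow> real \<Rightarrow> nat \<Rightarrow> real" where
  "b_seq t \<eta> \<alpha> L \<gamma> k =
    (1 - (\<Sum>i=1..t. \<alpha> (int k + 1 - int i)) - 2 * L * \<eta> k - \<gamma> * \<eta> k) / (2 * \<eta> k)"

definition a_seq :: "nat \<Rightarrow> (nat \<Rightarrow> real) \<Rightarrow> (int \<Rightarrow> real) \<Rightarrow> (int \<Rightarrow> real) \<Rightarrow> real \<Rightarrow> real
    \<Rightarrow> nat \<Rightarrow> nat \<Rightarrow> real" where
  "a_seq t \<eta> \<alpha> \<beta> L \<gamma> k i =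
    3 * L * real t * (\<beta> (int k + 1 - int i))\<^sup>2 / 2 + \<gamma> / 2 + \<alpha> (int k + 1 - int i) / (2 * \<eta> k)"

text \<open>
  The descent inequality is claimed at every iteration, and its derivation needs
  \<open>b_low \<le> b_k\<close> and \<open>a_{k,i} \<le> a_bar i\<close> at every iteration, the first ones included. Hence
  the lower and the upper limit over \<open>k \<in> \<nat>\<close> are taken to be the greatest lower and the least
  upper bound over all \<open>k\<close>; tail limits would say nothing about the early iterations.
\<close>

definition b_low :: "nat \<Rightarrow> (nat \<Rightarrow> real) \<Rightarrow> (int \<Rightarrow> real) \<Rightarrow> real \<Rightarrow> real \<Rightarrow> ereal" where
  "b_low t \<eta> \<alpha> L \<gamma> = (INF k. ereal (b_seq t \<eta> \<alpha> L \<gamma> k))"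

definition a_bar :: "nat \<Rightarrow> (nat \<Rightarrow> real) \<Rightarrow> (int \<Rightarrow> real) \<Rightarrow> (int \<Rightarrow> real) \<Rightarrow> real \<Rightarrow> real
    \<Rightarrow> nat \<Rightarrow> ereal" where
  "a_bar t \<eta> \<alpha> \<beta> L \<gamma> i = (SUP k. ereal (a_seq t \<eta> \<alpha> \<beta> L \<gamma> k i))"

definition lyapunov :: "('c::finite \<Rightarrow> 'r::finite) \<Rightarrow> real ^ 'i3::finite ^ 'i2::finite ^ 'i1::finite
    \<Rightarrow> (mode \<Rightarrow> 'r \<Rightarrow> ('c, 'r, 'i1, 'i2, 'i3) factors \<Rightarrow> ereal)
    \<Rightarrow> nat \<Rightarrow> (nat \<Rightarrow> ereal) \<Rightarrow> real \<Rightarrow> real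
    \<Rightarrow> (nat \<Rightarrow> 'w \<Rightarrow> ('c, 'r, 'i1, 'i2, 'i3) factors) \<Rightarrow> (nat \<Rightarrow> 'w \<Rightarrow> real)
    \<Rightarrow> nat \<Rightarrow> 'w \<Rightarrow> ereal" where
  "lyapunov q X h t a \<tau> \<gamma> A \<Gamma> k \<omega> =
    obj q X h (A k \<omega>)
    + (\<Sum>i=1..t+1. \<Sum>j=i..t+1.
        ereal (real (j + 1)) * a j * ereal ((norm (A (k + 1 - i) \<omega> - A (k - i) \<omega>))\<^sup>2))
    + ereal (1 / (2 * \<tau> * \<gamma>) * \<Gamma> k \<omega>)"

end

theory Submission
  imports Defs
begin

text \<open>
  Pathwise, the block descent lemma for the fit, applied from the extrapolated point to both
  \<open>A\<^sup>k\<^sup>+\<^sup>1\<close> and \<open>A\<^sup>k\<close>, and the minimality of the proximal step, compared with \<open>A\<^sup>k\<close>, bound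
  \<open>\<Phi>(A\<^sup>k\<^sup>+\<^sup>1)\<close> by \<open>\<Phi>(A\<^sup>k)\<close> minus \<open>b\<^sub>k\<close> times the squared new increment, plus multiples of the old squared
  increments and of the squared error of the stochastic gradient. The conditional expectation of
  that error is controlled by \<open>\<Gamma>\<^sub>k\<close>, whose contraction by \<open>1 - \<tau>\<close> pays for it, and the weighted old
  increments in the Lyapunov sequence telescope.

  The conditional expectations are only meaningful for measurable iterates. These are measurable
  because the proximal step is a Lipschitz function of its input, by strong convexity. As \<open>\<Phi>\<close> may
  take the value \<open>\<infinity>\<close>, the pathwise inequality is integrated in the extended nonnegative reals, with
  all terms of negative sign moved to the other side and a lower bound of \<open>\<Phi>\<close> subtracted.
\<close>

section \<open>Blocks and pieces of the factors\<close>

lemma UNIV_mode: "UNIV = {Mode1, Mode2, Mode3}"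
  using mode.exhaust by auto

lemma finite_UNIV_mode: "finite (UNIV :: mode set)"
  by (simp add: UNIV_mode)

lemma linear_cols: "linear (cols q r)"
  by (rule linearI) (auto simp: cols_def vec_eq_iff)

text \<open>Idempotent and self-adjoint maps are orthogonal projections. Both properties are shown
  for \<open>cols\<close>, \<open>block\<close> and \<open>piece\<close> in turn; the Frobenius
  estimates below rest on them and on the decompositions \<open>sum_piece\<close> and
  \<open>sum_block\<close>.\<close>

lemma cols_idem: "cols q r (cols q r M) = cols q r M"
  by (auto simp: cols_def vec_eq_iff)

lemma cols_adjoint: "cols q r M \<bullet> N = M \<bullet> cols q r N"
  by (auto simp: cols_def inner_vec_def intro!: sum.cong)

lemma sum_cols: "(\<Sum>r\<in>UNIV. cols q r M) = M"
  for q :: "'c::finite \<Rightarrow> 'r::finite"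
  by (simp add: vec_eq_iff cols_def)

lemma linear_block: "linear (block n)"
  by (rule linearI; cases n) auto

lemma block_idem: "block n (block n u) = block n u"
  by (cases n; cases u) auto

lemma block_adjoint: "block n u \<bullet> v = u \<bullet> block n v"
  by (cases n; cases u; cases v) (auto simp: inner_prod_def)

lemma sum_block: "(\<Sum>n\<in>UNIV. block n u) = u"
  by (cases u) (simp add: UNIV_mode)

lemma linear_piece: "linear (piece q n r)"
  by (rule linearI; cases n)
    (auto simp: linear_add[OF linear_cols] linear_scale[OF linear_cols])

lemma piece_idem: "piece q n r (piece q n r u) = piece q n r u"
  by (cases n; cases u) (auto simp: cols_idem)

lemma piece_adjoint: "piece q n r u \<bullet> v = u \<bullet> piece q n r v"
  by (cases n; cases u; cases v) (auto simp: inner_prod_def cols_adjoint)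

lemma sum_triple:
  "(\<Sum>x\<in>S. (f x, g x, h x)) = (sum f S, sum g S, sum h S)"
  by (induction S rule: infinite_finite_induct) (auto simp: zero_prod_def)

lemma sum_piece: "(\<Sum>r\<in>UNIV. piece q n r u) = block n u"
  by (cases u; cases n) (simp_all add: sum_triple sum_cols)

lemma piece_block: "piece q n r (block n u) = piece q n r u"
  by (cases n; cases u) auto

lemma piece_in_piece_space: "piece q n r u \<in> piece_space q n r"
  by (simp add: piece_space_def)

lemma subspace_piece_space: "subspace (piece_space q n r)"
  unfolding piece_space_def by (intro linear_subspace_image linear_piece) auto

lemma norm_block_le: "norm (block n u) \<le> norm u"
proof -
  have "(norm (block n u))\<^sup>2 = block n u \<bullet> u"
    by (simp add: power2_norm_eq_inner block_adjoint block_idem)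
  also have "\<dots> \<le> norm (block n u) * norm u"
    by (rule norm_cauchy_schwarz)
  finally show ?thesis
    by (cases "norm (block n u) = 0") (auto simp: power2_eq_square)
qed

lemma piece_inner: "piece q n r u \<bullet> piece q n r v = piece q n r u \<bullet> v"
  by (metis piece_adjoint piece_idem)

text \<open>Glues the separate column problems of a block together: their linear and quadratic terms
  add up to those of the whole block.\<close>

lemma sum_piece_inner: "(\<Sum>r\<in>UNIV. piece q n r u \<bullet> piece q n r v) = block n u \<bullet> v"
  by (simp add: piece_inner sum_piece flip: inner_sum_left)

text \<open>Meant for one iteration, in which only the sampled block moves: the other summands in
  \<open>sum_block\<close> vanish.\<close>

lemma block_diff_if_other_blocks_eq:
  assumes "\<And>m. m \<noteq> n \<Longrightarrow> block m y = block m x"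
  shows "block n (y - x) = y - x"
proof -
  have "y - x = (\<Sum>m\<in>UNIV. block m (y - x))"
    by (simp add: sum_block)
  also have "\<dots> = (\<Sum>m\<in>{n}. block m (y - x))"
    by (intro sum.mono_neutral_right)
      (simp_all add: assms linear_diff[OF linear_block] finite_UNIV_mode)
  finally show ?thesis by simp
qed

section \<open>Gradients\<close>

text \<open>In coordinates the fit is a polynomial in the entries of the factors, so the rules for
  sums and products apply.\<close>

lemma fit_differentiable: "fit q X differentiable (at A)"
  for q :: "'c::finite \<Rightarrow> 'r::finite" and X :: "real ^ 'i3::finite ^ 'i2::finite ^ 'i1::finite"
proof -
  have cols: "cols q r M $ i $ c = (if q c = r then M $ i $ c else 0)" for r :: 'r and i c and M :: "real^'c^'i::finite"
    by (simp add: cols_def)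
  have btd: "btd q A $ i $ j $ k = (\<Sum>r\<in>UNIV.
      (\<Sum>c\<in>UNIV. cols q r (fst A) $ i $ c * cols q r (fst (snd A)) $ j $ c) * snd (snd A) $ k $ r)"
    for i j k and A :: "('c, 'r, 'i1, 'i2, 'i3) factors"
    by (cases A) (simp add: matrix_matrix_mult_def transpose_def)
  have fit: "fit q X = (\<lambda>A.
      (\<Sum>i\<in>UNIV. \<Sum>j\<in>UNIV. \<Sum>k\<in>UNIV. (X $ i $ j $ k - btd q A $ i $ j $ k)\<^sup>2)
      / (2 * real (CARD('i1) * CARD('i2) * CARD('i3))))"
    by (intro ext) (simp only: fit_def power2_norm_eq_inner, simp add: inner_vec_def power2_eq_square)
  have comp: "(\<lambda>A. f A $ i) differentiable (at A)" if "f differentiable (at A)"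
    for f :: "('c, 'r, 'i1, 'i2, 'i3) factors \<Rightarrow> 'v::real_normed_vector^'s::finite" and i A
    using that unfolding differentiable_def by (blast intro: bounded_linear.has_derivative[OF bounded_linear_vec_nth])
  have fst: "fst differentiable (at (A::('c, 'r, 'i1, 'i2, 'i3) factors))"
     "(\<lambda>A. fst (snd A)) differentiable (at (A::('c, 'r, 'i1, 'i2, 'i3) factors))"
     "(\<lambda>A. snd (snd A)) differentiable (at (A::('c, 'r, 'i1, 'i2, 'i3) factors))" for A
    by (auto simp: differentiable_def intro!: exI derivative_eq_intros)
  have cond: "(\<lambda>A. if b then f A else 0) differentiable (at A)" if "f differentiable (at A)"
    for b and f :: "('c, 'r, 'i1, 'i2, 'i3) factors \<Rightarrow> real" and A
    using that by (cases b) simp_all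
  show ?thesis
    unfolding fit btd cols
    by (intro differentiable_divide differentiable_sum differentiable_power
        differentiable_diff differentiable_mult differentiable_const comp fst finite ballI cond) simp
qed

text \<open>\<open>grad\<close> is a definite description, so existence and uniqueness are both due.
  Existence comes from the Riesz vector of the derivative, which is its adjoint at
  \<open>1\<close>.\<close>

lemma GDERIV_grad:
  fixes F :: "'a::euclidean_space \<Rightarrow> real"
  assumes "F differentiable (at x)"
  shows "GDERIV F x :> grad F x"
proof -
  obtain F' where F': "(F has_derivative F') (at x)"
    using assms by (auto simp: differentiable_def)
  have lin: "linear F'" using F' has_derivative_linear by blast
  define D where "D = adjoint F' 1"
  have "F' = (\<lambda>v. v \<bullet> D)"
    using adjoint_works[OF lin, of _ 1] by (auto simp: D_def fun_eq_iff inner_commute)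
  then have "GDERIV F x :> D"
    using F' by (simp add: gderiv_def)
  then have "\<exists>!D. GDERIV F x :> D"
  proof (rule ex1I)
    fix E assume "GDERIV F x :> E"
    with \<open>GDERIV F x :> D\<close> have "(\<lambda>v. v \<bullet> E) = (\<lambda>v. v \<bullet> D)"
      unfolding gderiv_def by (blast intro: has_derivative_unique)
    then show "E = D" by (metis inner_commute vector_eq_ldot)
  qed
  then show ?thesis unfolding grad_def by (rule theI')
qed

lemma DERIV_along_line:
  fixes F :: "'a::euclidean_space \<Rightarrow> real"
  assumes "\<And>x. F differentiable (at x)"
  shows "((\<lambda>s. F (x + s *\<^sub>R d)) has_real_derivative grad F (x + s *\<^sub>R d) \<bullet> d) (at s)"
proof -
  have "(F has_derivative (\<lambda>v. v \<bullet> grad F (x + s *\<^sub>R d))) (at (x + s *\<^sub>R d))"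
    using GDERIV_grad[OF assms] by (simp add: gderiv_def)
  then have "((\<lambda>s. F (x + s *\<^sub>R d)) has_derivative (\<lambda>v. (v *\<^sub>R d) \<bullet> grad F (x + s *\<^sub>R d))) (at s)"
    by (rule has_derivative_compose[rotated]) (auto intro!: derivative_eq_intros)
  then show ?thesis
    unfolding has_field_derivative_def
    by (rule back_subst[of "\<lambda>f. (_ has_derivative f) _"]) (simp add: fun_eq_iff inner_commute)
qed

text \<open>Each coordinate is a pointwise limit of continuous difference quotients along a basis
  vector. This serves the measurability of \<open>grad_error\<close>.\<close>

lemma borel_measurable_grad:
  fixes F :: "'a::euclidean_space \<Rightarrow> real"
  assumes F: "\<And>x. F differentiable (at x)"
  shows "grad F \<in> borel_measurable borel"
proof (subst borel_measurable_euclidean_space, intro ballI)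
  fix b :: 'a
  have cont: "continuous_on UNIV F"
    by (meson F continuous_at_imp_continuous_on differentiable_imp_continuous_within)
  have "(\<lambda>n. (F (x + (1 / real (Suc n)) *\<^sub>R b) - F x) / (1 / real (Suc n))) \<longlonglongrightarrow> grad F x \<bullet> b" for x
  proof -
    have "((\<lambda>s. (F (x + s *\<^sub>R b) - F x) / s) \<longlongrightarrow> grad F x \<bullet> b) (at 0)"
      using DERIV_along_line[OF F, of x b 0] by (simp add: has_field_derivative_iff)
    moreover have "filterlim (\<lambda>n. 1 / real (Suc n)) (at 0) sequentially"
      unfolding filterlim_at
      using LIMSEQ_inverse_real_of_nat by (auto simp: inverse_eq_divide)
    ultimately show ?thesis
      by (rule filterlim_compose)
  qed
  then show "(\<lambda>x. grad F x \<bullet> b) \<in> borel_measurable borel"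
    by (rule borel_measurable_LIMSEQ_real)
      (auto intro!: borel_measurable_continuous_onI continuous_intros continuous_on_compose2[OF cont])
qed

text \<open>The descent lemma on a segment. Both signs are kept because the fit is later expanded
  from the extrapolated point towards two points, once for an upper and once for a lower
  bound.\<close>

lemma descent_along_line:
  fixes F :: "'a::euclidean_space \<Rightarrow> real"
  assumes F: "\<And>x. F differentiable (at x)"
    and lip: "\<And>s. 0 \<le> s \<Longrightarrow> s \<le> 1 \<Longrightarrow> \<bar>(grad F (x + s *\<^sub>R d) - grad F x) \<bullet> d\<bar> \<le> L * s * (norm d)\<^sup>2"
  shows "\<bar>F (x + d) - F x - grad F x \<bullet> d\<bar> \<le> L / 2 * (norm d)\<^sup>2"
proof -
  \<comment> \<open>The number \<open>c\<close> is a sign, so that one monotonicity argument yields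
    both bounds.\<close>
  have upper: "c * (F (x + d) - F x - grad F x \<bullet> d) \<le> L / 2 * (norm d)\<^sup>2" if "\<bar>c\<bar> = 1" for c
  proof -
    \<comment> \<open>Subtracting the quadratic makes the derivative nonpositive on the unit
      interval; \<open>\<psi> 1 \<le> \<psi> 0\<close> is then the claim.\<close>
    define \<psi> where "\<psi> s = c * (F (x + s *\<^sub>R d) - s * (grad F x \<bullet> d)) - L * (norm d)\<^sup>2 / 2 * s\<^sup>2" for s
    have "\<psi> 1 \<le> \<psi> 0"
    proof (rule DERIV_nonpos_imp_nonincreasing[where f = \<psi>])
      fix s :: real assume s: "0 \<le> s" "s \<le> 1"
      have "(\<psi> has_real_derivative c * (grad F (x + s *\<^sub>R d) \<bullet> d - grad F x \<bullet> d) - L * (norm d)\<^sup>2 / 2 * (2 * s)) (at s)"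
        unfolding \<psi>_def
        by (auto intro!: derivative_eq_intros DERIV_along_line F)
      moreover have "c * (grad F (x + s *\<^sub>R d) \<bullet> d - grad F x \<bullet> d) \<le> L * s * (norm d)\<^sup>2"
        using lip[OF s] that by (auto simp: inner_diff_left abs_real_def split: if_splits)
      ultimately show "\<exists>y. (\<psi> has_real_derivative y) (at s) \<and> y \<le> 0"
        by (intro exI conjI) (assumption, simp add: mult_ac)
    qed simp
    then show ?thesis
      by (simp add: \<psi>_def algebra_simps)
  qed
  from upper[of 1] upper[of "-1"] show ?thesis by (intro abs_leI) simp_all
qed

section \<open>Minimisers of a convex function plus a quadratic\<close>

lemma is_arg_min_le: "is_arg_min f P y \<Longrightarrow> P x \<Longrightarrow> f y \<le> f x"
  for f :: "'a \<Rightarrow> 'b::linorder"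
  by (auto simp: is_arg_min_def not_less)

text \<open>The minimiser is compared with points of the segment towards \<open>x\<close>. Convexity
  of \<open>F\<close> and the exact convexity defect of the squared norm leave a factor
  \<open>u\<close> on both sides; dividing by it and letting \<open>u\<close> tend to
  \<open>0\<close> gives the growth term.\<close>

lemma argmin_quadratic_growth:
  fixes F :: "'a::real_inner \<Rightarrow> ereal"
  assumes F: "proper_lsc_bdd_convex_on S F" and S: "convex S"
    and min: "is_arg_min (\<lambda>Y. F Y + ereal (g \<bullet> (Y - z) + c * (norm (Y - z))\<^sup>2)) (\<lambda>Y. Y \<in> S) y"
    and x: "x \<in> S"
  shows "F y + ereal (g \<bullet> (y - z) + c * (norm (y - z))\<^sup>2 + c * (norm (x - y))\<^sup>2)
    \<le> F x + ereal (g \<bullet> (x - z) + c * (norm (x - z))\<^sup>2)"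
proof (cases "F x = \<infinity>")
  case False
  define \<phi> where "\<phi> Y = g \<bullet> (Y - z) + c * (norm (Y - z))\<^sup>2" for Y
  have y: "y \<in> S"
    using min by (simp add: is_arg_min_def)
  have le: "F y + ereal (\<phi> y) \<le> F w + ereal (\<phi> w)" if "w \<in> S" for w
    using min that by (auto simp: is_arg_min_def \<phi>_def not_less)
  have fin: "F w \<noteq> -\<infinity>" if "w \<in> S" for w
    using F that by (auto simp: proper_lsc_bdd_convex_on_def)
  obtain a where a: "F x = ereal a"
    using False fin[OF x] by (cases "F x") auto
  obtain b where b: "F y = ereal b"
    using le[OF x] fin[OF y] by (cases "F y") (auto simp: a)
  have *: "b + \<phi> y + c * (1 - u) * (norm (x - y))\<^sup>2 \<le> a + \<phi> x" if u: "0 < u" "u < 1" for u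
  proof -
    define w where "w = u *\<^sub>R x + (1 - u) *\<^sub>R y"
    have w: "w \<in> S"
      using S x y u unfolding w_def by (auto intro!: convexD)
    have "F w \<le> ereal u * F x + ereal (1 - u) * F y"
      using F x y u unfolding w_def proper_lsc_bdd_convex_on_def by auto
    then have "F w \<le> ereal (u * a + (1 - u) * b)"
      by (simp add: a b)
    then have "ereal (b + \<phi> y) \<le> ereal (u * a + (1 - u) * b) + ereal (\<phi> w)"
      using le[OF w] by (cases "F w") (auto simp: b)
    moreover have "\<phi> w = u * \<phi> x + (1 - u) * \<phi> y - c * (u * (1 - u)) * (norm (x - y))\<^sup>2"
    proof -
      have sq: "(norm (u *\<^sub>R p + (1 - u) *\<^sub>R r))\<^sup>2 = u * (norm p)\<^sup>2 + (1 - u) * (norm r)\<^sup>2 - u * (1 - u) * (norm (p - r))\<^sup>2" for p r :: 'a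
        unfolding power2_norm_eq_inner
        by (simp only: inner_add_left inner_add_right inner_diff_left inner_diff_right
            inner_scaleR_left inner_scaleR_right inner_commute[of r p]) (simp add: algebra_simps)
      have wz: "w - z = u *\<^sub>R (x - z) + (1 - u) *\<^sub>R (y - z)"
        by (simp add: w_def algebra_simps)
      show ?thesis
        unfolding \<phi>_def wz sq by (simp add: inner_add_right algebra_simps)
    qed
    ultimately have "u * (b + \<phi> y + c * (1 - u) * (norm (x - y))\<^sup>2) \<le> u * (a + \<phi> x)"
      by (simp add: algebra_simps)
    then show ?thesis using u by simp
  qed
  have "b + \<phi> y + c * (norm (x - y))\<^sup>2 \<le> a + \<phi> x"
  proof (rule tendsto_upperbound)
    show "((\<lambda>u. b + \<phi> y + c * (1 - u) * (norm (x - y))\<^sup>2) \<longlongrightarrow> b + \<phi> y + c * (norm (x - y))\<^sup>2) (at_right 0)"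
      by (auto intro!: tendsto_eq_intros)
    show "\<forall>\<^sub>F u in at_right 0. b + \<phi> y + c * (1 - u) * (norm (x - y))\<^sup>2 \<le> a + \<phi> x"
      using * by (auto simp: eventually_at_right_field intro!: exI[of _ 1])
  qed simp
  then show ?thesis by (simp add: a b \<phi>_def)
qed simp

lemma argmin_finite:
  assumes F: "proper_lsc_bdd_convex_on S F"
    and min: "is_arg_min (\<lambda>Y. F Y + ereal (\<phi> Y)) (\<lambda>Y. Y \<in> S) y"
  shows "y \<in> S" "\<bar>F y\<bar> \<noteq> \<infinity>"
proof -
  obtain x where "x \<in> S" "F x \<noteq> \<infinity>" "F x \<noteq> -\<infinity>"
    using F unfolding proper_lsc_bdd_convex_on_def by auto
  moreover from this have "F y + ereal (\<phi> y) \<le> F x + ereal (\<phi> x)"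
    using min by (auto simp: is_arg_min_def not_less)
  moreover show "y \<in> S"
    using min by (simp add: is_arg_min_def)
  with F have "F y \<noteq> -\<infinity>"
    by (auto simp: proper_lsc_bdd_convex_on_def)
  ultimately show "\<bar>F y\<bar> \<noteq> \<infinity>"
    by (cases "F y"; cases "F x") auto
qed

text \<open>Quadratic growth is applied to each problem at the minimiser of the other. In the sum
  the values of \<open>F\<close> cancel. The data enter through
  \<open>(2 * c) *\<^sub>R z - g\<close> because, up to a constant, the minimised function depends
  on nothing else.\<close>

lemma argmin_lipschitz:
  fixes F :: "'a::real_inner \<Rightarrow> ereal"
  assumes F: "proper_lsc_bdd_convex_on S F" and S: "convex S" and c: "0 < c"
    and min: "is_arg_min (\<lambda>Y. F Y + ereal (g \<bullet> (Y - z) + c * (norm (Y - z))\<^sup>2)) (\<lambda>Y. Y \<in> S) y"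
    and min': "is_arg_min (\<lambda>Y. F Y + ereal (g' \<bullet> (Y - z') + c * (norm (Y - z'))\<^sup>2)) (\<lambda>Y. Y \<in> S) y'"
  shows "2 * c * norm (y - y') \<le> norm (((2 * c) *\<^sub>R z - g) - ((2 * c) *\<^sub>R z' - g'))"
proof -
  note y = argmin_finite[OF F min] and y' = argmin_finite[OF F min']
  obtain b b' where b: "F y = ereal b" "F y' = ereal b'"
    using y y' by auto
  define d where "d = ((2 * c) *\<^sub>R z - g) - ((2 * c) *\<^sub>R z' - g')"
  have "2 * c * (norm (y - y'))\<^sup>2 \<le> d \<bullet> (y - y')"
    using argmin_quadratic_growth[OF F S min y'(1)] argmin_quadratic_growth[OF F S min' y(1)]
    unfolding power2_norm_eq_inner
    by (simp add: b d_def inner_commute[of _ g] inner_commute[of _ g'] inner_commute[of y' y]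
        inner_commute[of z y] inner_commute[of z' y] inner_commute[of z y'] inner_commute[of z' y'] algebra_simps)
  also have "\<dots> \<le> norm d * norm (y - y')"
    by (rule norm_cauchy_schwarz)
  finally have "(2 * c * norm (y - y')) * norm (y - y') \<le> norm d * norm (y - y')"
    by (simp only: power2_eq_square mult.assoc)
  then show ?thesis
    unfolding d_def[symmetric] by (cases "y = y'") (auto dest: mult_right_le_imp_le)
qed

text \<open>The minimiser is a Lipschitz function of \<open>2 c z - g\<close> where it exists; extending this function
  to the closure of its domain replaces a proof that minimisers exist for all arguments.\<close>

lemma argmin_measurable:
  fixes F :: "'a::euclidean_space \<Rightarrow> ereal"
  assumes F: "proper_lsc_bdd_convex_on S F" and S: "convex S" and c: "0 < c"
  shows "\<exists>p\<in>borel_measurable borel. \<forall>g z y.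
    is_arg_min (\<lambda>Y. F Y + ereal (g \<bullet> (Y - z) + c * (norm (Y - z))\<^sup>2)) (\<lambda>Y. Y \<in> S) y
      \<longrightarrow> y = p ((2 * c) *\<^sub>R z - g)"
proof -
  \<comment> \<open>Different \<open>g\<close> and \<open>z\<close> may share the same
    \<open>v\<close>; \<open>argmin_lipschitz\<close> makes \<open>R\<close> single-valued all the
    same.\<close>
  define R where "R v y \<longleftrightarrow> (\<exists>g z. v = (2 * c) *\<^sub>R z - g \<and>
    is_arg_min (\<lambda>Y. F Y + ereal (g \<bullet> (Y - z) + c * (norm (Y - z))\<^sup>2)) (\<lambda>Y. Y \<in> S) y)" for v y
  have R: "2 * c * norm (y - y') \<le> norm (v - v')" if "R v y" "R v' y'" for v v' y y'
    using that unfolding R_def by (auto intro!: argmin_lipschitz[OF F S c])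
  define D where "D = {v. \<exists>y. R v y}"
  define f where "f v = (SOME y. R v y)" for v
  have f: "R v (f v)" if "v \<in> D" for v
    using that unfolding D_def f_def by (auto intro: someI)
  have "uniformly_continuous_on D f"
    unfolding uniformly_continuous_on_def dist_norm
  proof (intro allI impI)
    fix e :: real assume "0 < e"
    have "norm (f v' - f v) < e" if "v \<in> D" "v' \<in> D" "norm (v' - v) < 2 * c * e" for v v'
    proof -
      have "2 * c * norm (f v' - f v) < 2 * c * e"
        using R[OF f f, OF that(2,1)] that(3) by simp
      then show ?thesis using c by simp
    qed
    then show "\<exists>d>0. \<forall>x\<in>D. \<forall>x'\<in>D. norm (x' - x) < d \<longrightarrow> norm (f x' - f x) < e"
      using c \<open>0 < e\<close> by (intro exI[of _ "2 * c * e"]) auto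
  qed
  then obtain p where p: "uniformly_continuous_on (closure D) p" "\<And>v. v \<in> D \<Longrightarrow> f v = p v"
    by (rule uniformly_continuous_on_extension_on_closure) blast
  show ?thesis
  proof (intro bexI allI impI)
    \<comment> \<open>The extension is continuous on a closed set and constant off it, hence
      Borel.\<close>
    show "(\<lambda>v. if v \<in> closure D then p v else 0) \<in> borel_measurable borel"
      by (intro borel_measurable_continuous_on_if uniformly_continuous_imp_continuous p
          continuous_on_const) simp
    fix g z y
    assume "is_arg_min (\<lambda>Y. F Y + ereal (g \<bullet> (Y - z) + c * (norm (Y - z))\<^sup>2)) (\<lambda>Y. Y \<in> S) y"
    then have y: "R ((2 * c) *\<^sub>R z - g) y" (is "R ?v y") unfolding R_def by blast
    then have v: "?v \<in> D" by (auto simp: D_def)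
    have "y = f ?v"
      using R[OF y f[OF v]] c by (auto simp: mult_le_0_iff)
    then show "y = (if ?v \<in> closure D then p ?v else 0)"
      using p(2)[OF v] v closure_subset by auto
  qed
qed

text \<open>Semicontinuity relative to \<open>S\<close> makes the sets
  \<open>{u. a < F (P u)}\<close> open, as \<open>P\<close> is continuous and never leaves
  \<open>S\<close>. Later \<open>P\<close> is \<open>piece q n r\<close>, since a regularizer is
  only controlled on its \<open>piece_space\<close>.\<close>

lemma borel_measurable_lsc_comp:
  fixes F :: "'a::euclidean_space \<Rightarrow> ereal" and P :: "'b::euclidean_space \<Rightarrow> 'a"
  assumes F: "\<And>x. x \<in> S \<Longrightarrow> F x \<le> Liminf (at x within S) F"
    and P: "continuous_on UNIV P" "range P \<subseteq> S"
  shows "(\<lambda>u. F (P u)) \<in> borel_measurable borel"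
proof (rule borel_measurableI_greater)
  fix a
  have "open {u. a < F (P u)}"
  proof (subst open_subopen, intro ballI)
    fix u assume "u \<in> {u. a < F (P u)}"
    moreover have "P u \<in> S" using P(2) by auto
    ultimately have "a < Liminf (at (P u) within S) F"
      using F by (auto intro: less_le_trans)
    then have "eventually (\<lambda>y. a < F y) (at (P u) within S)"
      by (rule less_LiminfD)
    \<comment> \<open>The filter \<open>at\<close> omits the point \<open>P u\<close> itself; there
      the inequality holds by the choice of \<open>u\<close>.\<close>
    then obtain T where T: "open T" "P u \<in> T" "\<And>y. y \<in> T \<Longrightarrow> y \<noteq> P u \<Longrightarrow> y \<in> S \<Longrightarrow> a < F y"
      by (auto simp: eventually_at_topological)
    have "open (P -` T)"
      using P(1) T(1) open_vimage by blast
    then show "\<exists>T. open T \<and> u \<in> T \<and> T \<subseteq> {u. a < F (P u)}"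
      using T P(2) \<open>u \<in> _\<close> by (intro exI[of _ "P -` T"]) (auto, metis rangeI subsetD)
  qed
  then show "{u \<in> space borel. a < F (P u)} \<in> sets borel" by simp
qed

section \<open>Descent of the objective in one iteration\<close>

lemma exists_block_nonzero: "\<exists>u. block n u \<noteq> 0"
proof (cases n)
  case Mode1
  then show ?thesis by (intro exI[of _ "(\<chi> i j. 1, 0, 0)"]) (simp add: zero_prod_def vec_eq_iff)
next
  case Mode2
  then show ?thesis by (intro exI[of _ "(0, \<chi> i j. 1, 0)"]) (simp add: zero_prod_def vec_eq_iff)
next
  case Mode3
  then show ?thesis by (intro exI[of _ "(0, 0, \<chi> i j. 1)"]) (simp add: zero_prod_def vec_eq_iff)
qed

text \<open>The sign of \<open>L\<close> is forced by the Lipschitz bound itself: its left side is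
  nonnegative, and some two blocks have positive distance.\<close>

lemma block_lipschitz_nonneg:
  fixes x :: "('c::finite, 'r::finite, 'i1::finite, 'i2::finite, 'i3::finite) factors"
  assumes "\<And>Y Y'. norm (block_grad q X n (replace_block n x Y) - block_grad q X n (replace_block n x Y'))
      \<le> L * norm (block n Y - block n Y')"
  shows "0 \<le> L"
proof -
  obtain u where u: "block n u \<noteq> (0 :: ('c, 'r, 'i1, 'i2, 'i3) factors)"
    using exists_block_nonzero by blast
  have "0 \<le> L * norm (block n u - block n 0)"
    using assms[of u 0] norm_ge_zero order_trans by blast
  then show ?thesis
    using u by (simp add: linear_0[OF linear_block] zero_le_mult_iff)
qed

text \<open>Along a direction inside block \<open>n\<close> all points
  \<open>w + s *\<^sub>R d\<close> agree with \<open>x\<close> off this block, so the blockwise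
  Lipschitz bound applies; the other blocks of the gradient are orthogonal to
  \<open>d\<close>.\<close>

lemma fit_block_descent:
  assumes lip: "\<And>Y Y'. norm (block_grad q X n (replace_block n x Y) - block_grad q X n (replace_block n x Y'))
      \<le> L * norm (block n Y - block n Y')"
    and w: "replace_block n x w = w" and d: "block n d = d"
  shows "\<bar>fit q X (w + d) - fit q X w - grad (fit q X) w \<bullet> d\<bar> \<le> L / 2 * (norm d)\<^sup>2"
proof (rule descent_along_line[OF fit_differentiable])
  fix s :: real assume s: "0 \<le> s" "s \<le> 1"
  let ?v = "w + s *\<^sub>R d"
  have v: "replace_block n x ?v = ?v"
    using w by (simp add: replace_block_def linear_add[OF linear_block] linear_scale[OF linear_block] d)
  have "(grad (fit q X) ?v - grad (fit q X) w) \<bullet> d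
      = (block_grad q X n ?v - block_grad q X n w) \<bullet> d"
    unfolding block_grad_def linear_diff[OF linear_block, symmetric] block_adjoint d ..
  then have "\<bar>(grad (fit q X) ?v - grad (fit q X) w) \<bullet> d\<bar>
      \<le> norm (block_grad q X n ?v - block_grad q X n w) * norm d"
    by (simp add: Cauchy_Schwarz_ineq2)
  also have "\<dots> \<le> (L * norm (block n ?v - block n w)) * norm d"
    using lip[of ?v w] by (intro mult_right_mono) (simp_all add: v w)
  also have "block n ?v - block n w = s *\<^sub>R d"
    by (simp add: linear_add[OF linear_block] linear_scale[OF linear_block] d)
  also have "(L * norm (s *\<^sub>R d)) * norm d = L * s * (norm d)\<^sup>2"
    using s by (simp add: power2_eq_square)
  finally show "\<bar>(grad (fit q X) ?v - grad (fit q X) w) \<bullet> d\<bar> \<le> L * s * (norm d)\<^sup>2" .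
qed

lemma young_inner:
  fixes u v :: "'a::real_inner"
  assumes "0 < \<gamma>"
  shows "u \<bullet> v \<le> (norm u)\<^sup>2 / (2 * \<gamma>) + \<gamma> / 2 * (norm v)\<^sup>2"
proof -
  have "0 \<le> (norm (u - \<gamma> *\<^sub>R v))\<^sup>2" by simp
  also have "\<dots> = (norm u)\<^sup>2 + \<gamma>\<^sup>2 * (norm v)\<^sup>2 - 2 * \<gamma> * (u \<bullet> v)"
    unfolding power2_norm_eq_inner
    by (simp add: inner_diff_left inner_diff_right inner_commute[of v u] power2_eq_square algebra_simps)
  finally have "2 * \<gamma> * (u \<bullet> v) \<le> (norm u)\<^sup>2 + \<gamma>\<^sup>2 * (norm v)\<^sup>2" by simp
  then show ?thesis
    using assms by (simp add: divide_simps power2_eq_square) (simp add: algebra_simps)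
qed

text \<open>Every piece is compared with the competitor \<open>piece q n r x\<close>, and the
  inequalities are added up over the columns.\<close>

lemma prox_piece_step:
  assumes min: "\<And>r. is_arg_min
        (\<lambda>Y. let D = Y - piece q n r xt in
          h n r Y + ereal (piece q n r g \<bullet> D + 1 / (2 * \<eta>) * (norm D)\<^sup>2))
        (\<lambda>Y. Y \<in> piece_space q n r) (piece q n r y)"
    and "block n (y - x) = y - x"
  shows "(\<Sum>r\<in>UNIV. h n r (piece q n r y))
    \<le> (\<Sum>r\<in>UNIV. h n r (piece q n r x))
      + ereal (- (block n g \<bullet> (y - x)) - (norm (y - x))\<^sup>2 / (2 * \<eta>) + (y - x) \<bullet> (xt - x) / \<eta>)"
proof -
  define e d where "e = xt - x" and "d = y - x"
  have sub: "x - xt = - e" "y - xt = d - e" "y - x = d" and d: "block n d = d"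
    using assms(2) by (auto simp: e_def d_def)
  have "block n e \<bullet> d = d \<bullet> e"
    using block_adjoint[of n e d] by (simp only: d inner_commute[of e d])
  then have sq: "block n (d - e) \<bullet> (d - e) = block n e \<bullet> e + d \<bullet> d - 2 * (d \<bullet> e)"
    by (simp add: linear_diff[OF linear_block] d inner_diff_left inner_diff_right)
  have sq': "block n (- e) \<bullet> (- e) = block n e \<bullet> e"
    by (simp add: linear_neg[OF linear_block])
  \<comment> \<open>The terms quadratic in the offset \<open>e\<close> cancel, which leaves the
    squared increment and its inner product with \<open>e\<close>.\<close>
  have K: "block n g \<bullet> (x - xt) + 1 / (2 * \<eta>) * (block n (x - xt) \<bullet> (x - xt))
      - (block n g \<bullet> (y - xt) + 1 / (2 * \<eta>) * (block n (y - xt) \<bullet> (y - xt)))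
    = - (block n g \<bullet> (y - x)) - (norm (y - x))\<^sup>2 / (2 * \<eta>) + (y - x) \<bullet> (xt - x) / \<eta>"
    unfolding sub e_def[symmetric] sq sq' power2_norm_eq_inner
    by (simp add: inner_diff_right add_divide_distrib diff_divide_distrib)
  define \<phi> where "\<phi> u r = piece q n r g \<bullet> piece q n r (u - xt) + 1 / (2 * \<eta>) * (norm (piece q n r (u - xt)))\<^sup>2" for u r
  have \<phi>: "(\<Sum>r\<in>UNIV. \<phi> u r) = block n g \<bullet> (u - xt) + 1 / (2 * \<eta>) * (block n (u - xt) \<bullet> (u - xt))" for u
    unfolding \<phi>_def power2_norm_eq_inner
    by (simp add: sum.distrib sum_piece_inner flip: sum_divide_distrib)
  have "h n r (piece q n r y) \<le> h n r (piece q n r x) + ereal (\<phi> x r - \<phi> y r)" for r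
  proof -
    have "h n r (piece q n r y) + ereal (\<phi> y r) \<le> h n r (piece q n r x) + ereal (\<phi> x r)"
      using is_arg_min_le[OF min[of r] piece_in_piece_space[of q n r x]]
      by (simp add: Let_def \<phi>_def linear_diff[OF linear_piece])
    then show ?thesis
      by (cases "h n r (piece q n r y)"; cases "h n r (piece q n r x)") auto
  qed
  then have "(\<Sum>r\<in>UNIV. h n r (piece q n r y)) \<le> (\<Sum>r\<in>UNIV. h n r (piece q n r x) + ereal (\<phi> x r - \<phi> y r))"
    by (intro sum_mono)
  also have "\<dots> = (\<Sum>r\<in>UNIV. h n r (piece q n r x)) + ereal ((\<Sum>r\<in>UNIV. \<phi> x r) - (\<Sum>r\<in>UNIV. \<phi> y r))"
    by (simp add: sum.distrib sum_subtractf)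
  finally show ?thesis
    by (simp only: \<phi> K)
qed

text \<open>The fit is expanded at \<open>w\<close>, which is \<open>x\<close> with its block
  \<open>n\<close> extrapolated: from above at \<open>y\<close>, from below at \<open>x\<close>. Its
  gradient along \<open>d\<close> meets the stochastic gradient from the proximal step; only their
  difference \<open>\<epsilon>\<close> survives, and Young's inequality with weight
  \<open>\<gamma>\<close> splits it.\<close>

lemma block_step_descent:
  assumes other: "\<And>m. m \<noteq> n \<Longrightarrow> block m y = block m x"
    and min: "\<And>r. is_arg_min
        (\<lambda>Y. let D = Y - piece q n r xt in
          h n r Y + ereal (piece q n r g \<bullet> D + 1 / (2 * \<eta>) * (norm D)\<^sup>2))
        (\<lambda>Y. Y \<in> piece_space q n r) (piece q n r y)"
    and lip: "\<And>Y Y'. norm (block_grad q X n (replace_block n x Y) - block_grad q X n (replace_block n x Y'))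
      \<le> L * norm (block n Y - block n Y')"
    and \<gamma>: "0 < \<gamma>"
  shows "obj q X h y \<le> obj q X h x
    + ereal ((norm (block n g - block_grad q X n (replace_block n x xb)))\<^sup>2 / (2 * \<gamma>)
        + (\<gamma> / 2 + L - 1 / (2 * \<eta>)) * (norm (y - x))\<^sup>2
        + 3 / 2 * L * (norm (xb - x))\<^sup>2 + (y - x) \<bullet> (xt - x) / \<eta>)"
proof -
  define d where "d = y - x"
  define e where "e = block n (xb - x)"
  define w where "w = replace_block n x xb"
  define K where "K = - (block n g \<bullet> d) - (norm d)\<^sup>2 / (2 * \<eta>) + d \<bullet> (xt - x) / \<eta>"
  define \<epsilon> where "\<epsilon> = block n g - block_grad q X n w"
  have L: "0 \<le> L" by (rule block_lipschitz_nonneg[OF lip])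
  have d: "block n d = d"
    unfolding d_def by (rule block_diff_if_other_blocks_eq[OF other])
  have e: "block n e = e" by (simp add: e_def block_idem)
  have xw: "x = w - e" and yw: "y = w + (d - e)"
    by (simp_all add: w_def e_def d_def replace_block_def linear_diff[OF linear_block])
  have w: "replace_block n x w = w"
    by (simp add: w_def replace_block_def linear_add[OF linear_block] linear_diff[OF linear_block] block_idem)
  have "fit q X y \<le> fit q X w + grad (fit q X) w \<bullet> (d - e) + L / 2 * (norm (d - e))\<^sup>2"
    using abs_le_D1[OF fit_block_descent[OF lip w, of "d - e"]]
    by (simp add: linear_diff[OF linear_block] d e yw[symmetric])
  moreover have "fit q X w - grad (fit q X) w \<bullet> e - L / 2 * (norm e)\<^sup>2 \<le> fit q X x"
    using abs_le_D2[OF fit_block_descent[OF lip w, of "- e"]]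
    by (simp add: linear_neg[OF linear_block] e xw[symmetric])
  \<comment> \<open>This contributes \<open>L\<close> for \<open>d\<close> and \<open>L\<close> for
    \<open>e\<close>; the lower bound at \<open>x\<close> adds another \<open>L / 2\<close> for
    \<open>e\<close>, hence the constant \<open>3 / 2 * L\<close>.\<close>
  moreover have "L / 2 * (norm (d - e))\<^sup>2 \<le> L / 2 * (2 * (norm d)\<^sup>2 + 2 * (norm e)\<^sup>2)"
  proof -
    have "(norm (d - e))\<^sup>2 + (norm (d + e))\<^sup>2 = 2 * (norm d)\<^sup>2 + 2 * (norm e)\<^sup>2"
      unfolding power2_norm_eq_inner by (simp add: inner_diff_left inner_diff_right inner_add_left inner_add_right)
    then have "(norm (d - e))\<^sup>2 \<le> 2 * (norm d)\<^sup>2 + 2 * (norm e)\<^sup>2"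
      using zero_le_power2[of "norm (d + e)"] by linarith
    then show ?thesis using L by (intro mult_left_mono) auto
  qed
  moreover have "L * (norm e)\<^sup>2 \<le> L * (norm (xb - x))\<^sup>2"
    using L unfolding e_def by (intro mult_left_mono power_mono norm_block_le) auto
  moreover have "grad (fit q X) w \<bullet> d = block n g \<bullet> d - \<epsilon> \<bullet> d"
    by (simp add: \<epsilon>_def block_grad_def inner_diff_left block_adjoint d)
  moreover have "- \<epsilon> \<bullet> d \<le> (norm \<epsilon>)\<^sup>2 / (2 * \<gamma>) + \<gamma> / 2 * (norm d)\<^sup>2"
    using young_inner[OF \<gamma>, of "- \<epsilon>" d] by simp
  ultimately have fit: "fit q X y \<le> fit q X x + ((norm \<epsilon>)\<^sup>2 / (2 * \<gamma>)
      + (\<gamma> / 2 + L) * (norm d)\<^sup>2 + 3 / 2 * L * (norm (xb - x))\<^sup>2 + block n g \<bullet> d)"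
    by (simp add: inner_diff_right algebra_simps)
  define H where "H u m = (\<Sum>r\<in>UNIV. h m r (piece q m r u))" for u m
  \<comment> \<open>Off block \<open>n\<close> the regularizers keep their values, so the proximal
    estimate for one block carries over to the whole sum.\<close>
  have "H y m = H x m" if "m \<noteq> n" for m
    using arg_cong[OF other[OF that], of "piece q m _"] by (simp add: H_def piece_block)
  moreover have "H y n \<le> H x n + ereal K"
    unfolding H_def K_def d_def
    using prox_piece_step[where h = h and q = q and n = n and x = x and y = y and xt = xt and g = g
        and \<eta> = \<eta>, OF min] d
    by (simp add: d_def)
  ultimately have "(\<Sum>m\<in>UNIV. H y m) \<le> (H x n + ereal K) + (\<Sum>m\<in>UNIV - {n}. H x m)"
    by (simp add: sum.remove[OF finite_UNIV_mode, of n] add_right_mono)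
  also have "\<dots> = (\<Sum>m\<in>UNIV. H x m) + ereal K"
    by (simp add: sum.remove[OF finite_UNIV_mode, of n] ac_simps)
  finally have "(\<Sum>m\<in>UNIV. H y m) \<le> (\<Sum>m\<in>UNIV. H x m) + ereal K" .
  then have "ereal (fit q X y) + (\<Sum>m\<in>UNIV. H y m)
      \<le> ereal (fit q X x + ((norm \<epsilon>)\<^sup>2 / (2 * \<gamma>)
      + (\<gamma> / 2 + L) * (norm d)\<^sup>2 + 3 / 2 * L * (norm (xb - x))\<^sup>2 + block n g \<bullet> d))
      + ((\<Sum>m\<in>UNIV. H x m) + ereal K)"
    using fit by (intro add_mono) simp_all
  also have "\<dots> = (ereal (fit q X x) + (\<Sum>m\<in>UNIV. H x m))
      + ereal ((norm \<epsilon>)\<^sup>2 / (2 * \<gamma>) + (\<gamma> / 2 + L - 1 / (2 * \<eta>)) * (norm d)\<^sup>2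
        + 3 / 2 * L * (norm (xb - x))\<^sup>2 + d \<bullet> (xt - x) / \<eta>)"
    unfolding K_def by (cases "\<Sum>m\<in>UNIV. H x m") (simp_all add: algebra_simps)
  finally show ?thesis
    by (simp only: obj_def UNIV_mode[symmetric] H_def d_def \<epsilon>_def w_def)
qed

section \<open>Inertial terms and one step of the algorithm\<close>

lemma inner_sum_le:
  fixes d :: "'a::real_inner"
  assumes "\<And>i. i \<in> I \<Longrightarrow> 0 \<le> c i"
  shows "d \<bullet> (\<Sum>i\<in>I. c i *\<^sub>R v i) \<le> (\<Sum>i\<in>I. c i * ((norm d)\<^sup>2 + (norm (v i))\<^sup>2) / 2)"
  unfolding inner_sum_right
proof (rule sum_mono)
  fix i assume "i \<in> I"
  then have "c i * (d \<bullet> v i) \<le> c i * (((norm d)\<^sup>2 + (norm (v i))\<^sup>2) / 2)"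
    using young_inner[of 1 d "v i"] by (intro mult_left_mono assms) auto
  then show "d \<bullet> c i *\<^sub>R v i \<le> c i * ((norm d)\<^sup>2 + (norm (v i))\<^sup>2) / 2" by simp
qed

text \<open>Cauchy-Schwarz against the constant \<open>1\<close>; this is the source of the factor
  \<open>t\<close> in \<open>a_seq\<close>.\<close>

lemma norm_sum_power2_le:
  fixes v :: "nat \<Rightarrow> 'a::real_inner"
  shows "(norm (\<Sum>i=1..t. c i *\<^sub>R v i))\<^sup>2 \<le> real t * (\<Sum>i=1..t. (c i)\<^sup>2 * (norm (v i))\<^sup>2)"
proof -
  have "(norm (\<Sum>i=1..t. c i *\<^sub>R v i))\<^sup>2 \<le> (\<Sum>i=1..t. norm (c i *\<^sub>R v i))\<^sup>2"
    by (intro power_mono norm_sum) simp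
  also have "\<dots> \<le> (\<Sum>i=1..t. (norm (c i *\<^sub>R v i))\<^sup>2) * (\<Sum>i=1..t. 1\<^sup>2)"
    using Cauchy_Schwarz_ineq_sum[of "\<lambda>i. norm (c i *\<^sub>R v i)" "\<lambda>_. 1" "{1..t}"] by simp
  finally show ?thesis by (simp add: power_mult_distrib mult.commute)
qed

text \<open>Sorts the terms of \<open>block_step_descent\<close> by increments. The new one gets
  exactly \<open>- b_seq\<close>. The old ones get \<open>a_seq\<close> less
  \<open>\<gamma> / 2\<close>, a share that is held back for the variance of the estimator.\<close>

lemma midas_step_descent:
  fixes A :: "nat \<Rightarrow> ('c::finite, 'r::finite, 'i1::finite, 'i2::finite, 'i3::finite) factors"
  assumes other: "\<And>m. m \<noteq> n \<Longrightarrow> block m (A (Suc k)) = block m (A k)"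
    and min: "\<And>r. is_arg_min
        (\<lambda>Y. let D = Y - piece q n r (extrapolate t \<alpha> A k) in
          h n r Y + ereal (piece q n r g \<bullet> D + 1 / (2 * \<eta> k) * (norm D)\<^sup>2))
        (\<lambda>Y. Y \<in> piece_space q n r) (piece q n r (A (Suc k)))"
    and lip: "\<And>Y Y'. norm (block_grad q X n (replace_block n (A k) Y) - block_grad q X n (replace_block n (A k) Y'))
      \<le> L * norm (block n Y - block n Y')"
    and \<gamma>: "0 < \<gamma>" and \<eta>: "0 < \<eta> k" and \<alpha>: "\<And>j. 0 \<le> \<alpha> j"
  shows "obj q X h (A (Suc k)) \<le> obj q X h (A k)
    + ereal ((norm (block n g - block_grad q X n (replace_block n (A k) (extrapolate t \<beta> A k))))\<^sup>2 / (2 * \<gamma>)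
        - b_seq t \<eta> \<alpha> L \<gamma> k * (norm (A (Suc k) - A k))\<^sup>2
        + (\<Sum>i=1..t. (a_seq t \<eta> \<alpha> \<beta> L \<gamma> k i - \<gamma> / 2) * (norm (A (k + 1 - i) - A (k - i)))\<^sup>2))"
proof -
  define d where "d = A (Suc k) - A k"
  define v where "v i = A (k + 1 - i) - A (k - i)" for i
  define \<alpha>' \<beta>' where "\<alpha>' i = \<alpha> (int k + 1 - int i)" and "\<beta>' i = \<beta> (int k + 1 - int i)" for i :: nat
  have L: "0 \<le> L" by (rule block_lipschitz_nonneg[OF lip])
  \<comment> \<open>The inertial term is split evenly: one half goes to the new increment and yields
    the sum of the \<open>\<alpha>\<close> in \<open>b_seq\<close>, the other half goes to the old
    increments.\<close>
  have "d \<bullet> (extrapolate t \<alpha> A k - A k) / \<eta> k \<le> (\<Sum>i=1..t. \<alpha>' i * ((norm d)\<^sup>2 + (norm (v i))\<^sup>2) / 2) / \<eta> k"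
    using inner_sum_le[of "{1..t}" \<alpha>' d v] \<alpha> \<eta>
    by (intro divide_right_mono) (simp_all add: extrapolate_def \<alpha>'_def v_def)
  also have "\<dots> = (\<Sum>i=1..t. \<alpha>' i) / (2 * \<eta> k) * (norm d)\<^sup>2 + (\<Sum>i=1..t. \<alpha>' i / (2 * \<eta> k) * (norm (v i))\<^sup>2)"
    by (simp add: sum_divide_distrib sum_distrib_right ring_distribs add_divide_distrib sum.distrib)
  finally have 1: "d \<bullet> (extrapolate t \<alpha> A k - A k) / \<eta> k \<le> \<dots>" .
  have "3 / 2 * L * (norm (extrapolate t \<beta> A k - A k))\<^sup>2 \<le> 3 / 2 * L * (real t * (\<Sum>i=1..t. (\<beta>' i)\<^sup>2 * (norm (v i))\<^sup>2))"
    using norm_sum_power2_le[of \<beta>' v t] L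
    by (intro mult_left_mono) (simp_all add: extrapolate_def \<beta>'_def v_def)
  also have "\<dots> = (\<Sum>i=1..t. 3 * L * real t * (\<beta>' i)\<^sup>2 / 2 * (norm (v i))\<^sup>2)"
    by (simp add: sum_distrib_left mult_ac)
  finally have 2: "3 / 2 * L * (norm (extrapolate t \<beta> A k - A k))\<^sup>2 \<le> \<dots>" .
  have 3: "(\<Sum>i=1..t. (a_seq t \<eta> \<alpha> \<beta> L \<gamma> k i - \<gamma> / 2) * (norm (v i))\<^sup>2)
      = (\<Sum>i=1..t. \<alpha>' i / (2 * \<eta> k) * (norm (v i))\<^sup>2) + (\<Sum>i=1..t. 3 * L * real t * (\<beta>' i)\<^sup>2 / 2 * (norm (v i))\<^sup>2)"
    unfolding sum.distrib[symmetric] by (intro sum.cong refl) (simp add: a_seq_def \<alpha>'_def \<beta>'_def ring_distribs)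
  have 4: "b_seq t \<eta> \<alpha> L \<gamma> k = 1 / (2 * \<eta> k) - (\<Sum>i=1..t. \<alpha>' i) / (2 * \<eta> k) - L - \<gamma> / 2"
    using \<eta> unfolding b_seq_def \<alpha>'_def[symmetric] by (simp add: field_simps)
  note block_step_descent[where q = q and X = X and h = h and L = L and n = n and x = "A k"
      and y = "A (Suc k)" and \<eta> = "\<eta> k" and g = g
      and xt = "extrapolate t \<alpha> A k" and xb = "extrapolate t \<beta> A k", OF other min lip \<gamma>]
  also have "(norm (block n g - block_grad q X n (replace_block n (A k) (extrapolate t \<beta> A k))))\<^sup>2 / (2 * \<gamma>)
      + (\<gamma> / 2 + L - 1 / (2 * \<eta> k)) * (norm (A (Suc k) - A k))\<^sup>2
      + 3 / 2 * L * (norm (extrapolate t \<beta> A k - A k))\<^sup>2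
      + (A (Suc k) - A k) \<bullet> (extrapolate t \<alpha> A k - A k) / \<eta> k
    \<le> (norm (block n g - block_grad q X n (replace_block n (A k) (extrapolate t \<beta> A k))))\<^sup>2 / (2 * \<gamma>)
        - b_seq t \<eta> \<alpha> L \<gamma> k * (norm (A (Suc k) - A k))\<^sup>2
        + (\<Sum>i=1..t. (a_seq t \<eta> \<alpha> \<beta> L \<gamma> k i - \<gamma> / 2) * (norm (A (k + 1 - i) - A (k - i)))\<^sup>2)"
    unfolding v_def[symmetric] d_def[symmetric] 3 unfolding 4 left_diff_distrib distrib_right
    using 1 2 by linarith
  finally show ?thesis
    by (simp add: add_left_mono)
qed

section \<open>Measurability of the iterates\<close>

lemma continuous_on_linear:
  fixes f :: "'a::euclidean_space \<Rightarrow> 'b::real_normed_vector"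
  assumes "linear f"
  shows "continuous_on S f"
  using assms by (simp add: linear_continuous_on linear_conv_bounded_linear)

lemma borel_measurable_linear:
  fixes f :: "'a::euclidean_space \<Rightarrow> 'b::real_normed_vector"
  assumes "linear f"
  shows "f \<in> borel_measurable borel"
  by (intro borel_measurable_continuous_onI continuous_on_linear assms)

lemma borel_measurable_fit: "fit q X \<in> borel_measurable borel"
  by (intro borel_measurable_continuous_onI continuous_at_imp_continuous_on ballI
      differentiable_imp_continuous_within fit_differentiable)

lemma borel_measurable_obj:
  assumes "\<And>n r. proper_lsc_bdd_convex_on (piece_space q n r) (h n r)"
  shows "obj q X h \<in> borel_measurable borel"
proof -
  have "(\<lambda>A. h n r (piece q n r A)) \<in> borel_measurable borel" for n r
    using assms[of n r] by (intro borel_measurable_lsc_comp[of "piece_space q n r"])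
      (auto simp: proper_lsc_bdd_convex_on_def piece_space_def intro: continuous_on_linear linear_piece)
  then show ?thesis
    unfolding obj_def[abs_def]
    by (intro borel_measurable_ereal_add borel_measurable_ereal borel_measurable_ereal_sum borel_measurable_fit)
qed

text \<open>This constant is later subtracted from the objective, so that nonnegative conditional
  expectations apply to it.\<close>

lemma obj_lower_bound:
  assumes "\<And>n r. proper_lsc_bdd_convex_on (piece_space q n r) (h n r)"
  obtains c :: real where "\<And>A. ereal c \<le> obj q X h A"
proof -
  have "\<exists>c::real. \<forall>A. ereal c \<le> h n r (piece q n r A)" for n r
    using assms[of n r] by (auto simp: proper_lsc_bdd_convex_on_def piece_space_def)
  then obtain c where c: "\<And>n r A. ereal (c n r) \<le> h n r (piece q n r A)"
    by metis
  have "ereal (\<Sum>n\<in>UNIV. \<Sum>r\<in>UNIV. c n r) \<le> obj q X h A" for A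
  proof -
    have "ereal 0 + (\<Sum>n\<in>UNIV. \<Sum>r\<in>UNIV. ereal (c n r)) \<le> obj q X h A"
      unfolding obj_def UNIV_mode[symmetric]
      by (intro add_mono sum_mono c) (simp add: fit_def)
    then show ?thesis by simp
  qed
  then show thesis by (rule that)
qed

section \<open>The filtration generated by the samples\<close>

lemma space_history: "space (history M Z \<xi> \<zeta> k) = space M"
  unfolding history_def by (intro space_measure_of) auto

lemma sets_history:
  "sets (history M Z \<xi> \<zeta> k) = sigma_sets (space M)
    (\<Union>j<k. {\<xi> j -` B \<inter> space M | B. B \<in> UNIV} \<union> {\<zeta> j -` B \<inter> space M | B. B \<in> sets Z})"
  unfolding history_def by (intro sets_measure_of) auto

lemma subalgebra_history:
  assumes "\<And>j. \<xi> j \<in> M \<rightarrow>\<^sub>M count_space UNIV" "\<And>j. \<zeta> j \<in> M \<rightarrow>\<^sub>M Z"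
  shows "subalgebra M (history M Z \<xi> \<zeta> k)"
  unfolding subalgebra_def space_history sets_history
proof (intro conjI refl sets.sigma_sets_subset subsetI)
  fix S assume "S \<in> (\<Union>j<k. {\<xi> j -` B \<inter> space M | B. B \<in> UNIV} \<union> {\<zeta> j -` B \<inter> space M | B. B \<in> sets Z})"
  then show "S \<in> sets M"
    using measurable_sets[OF assms(1)] measurable_sets[OF assms(2)] by auto
qed

lemma subalgebra_history_mono:
  assumes "j \<le> k"
  shows "subalgebra (history M Z \<xi> \<zeta> k) (history M Z \<xi> \<zeta> j)"
  unfolding subalgebra_def space_history sets_history
  using assms by (intro conjI refl sigma_sets_mono' UN_mono) auto

lemma measurable_history_block:
  assumes "j < k"
  shows "\<xi> j \<in> history M Z \<xi> \<zeta> k \<rightarrow>\<^sub>M count_space UNIV"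
proof (rule measurableI)
  fix B :: "mode set"
  show "\<xi> j -` B \<inter> space (history M Z \<xi> \<zeta> k) \<in> sets (history M Z \<xi> \<zeta> k)"
    unfolding space_history sets_history using assms
    by (intro sigma_sets.Basic UN_I[of j]) auto
qed simp

text \<open>The random mode takes finitely many values, so measurability may be checked with the
  mode frozen.\<close>

lemma measurable_compose_mode:
  assumes "\<xi> \<in> M \<rightarrow>\<^sub>M count_space UNIV" "\<And>n. f n \<in> borel_measurable M"
  shows "(\<lambda>\<omega>. f (\<xi> \<omega> :: mode) \<omega>) \<in> borel_measurable M"
  by (rule measurable_compose_countable'[OF assms(2,1)]) (simp add: countable_finite finite_UNIV_mode)

lemma borel_measurable_extrapolate:
  fixes A :: "nat \<Rightarrow> 'w \<Rightarrow> 'a::euclidean_space"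
  assumes "\<And>j. j \<le> k \<Longrightarrow> A j \<in> borel_measurable N"
  shows "(\<lambda>\<omega>. extrapolate t c (\<lambda>j. A j \<omega>) k) \<in> borel_measurable N"
  unfolding extrapolate_def using assms
  by (intro borel_measurable_add borel_measurable_sum borel_measurable_scaleR borel_measurable_const borel_measurable_diff) auto

text \<open>Each iterate is assembled from measurable pieces: the proximal map gives those of the
  sampled block, the previous iterate the others. The induction is strong because extrapolation
  reaches several iterates back.\<close>

lemma measurable_iterates:
  assumes alg: "midas_ll1 M Z \<xi> \<zeta> fib B q h t \<eta> \<alpha> A0 G A"
    and reg: "\<And>n r. proper_lsc_bdd_convex_on (piece_space q n r) (h n r)"
    and \<eta>: "\<And>k. 0 < \<eta> k"
  shows "A k \<in> borel_measurable (history M Z \<xi> \<zeta> k)"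
proof (induction k rule: less_induct)
  case (less k)
  let ?F = "\<lambda>k. history M Z \<xi> \<zeta> k"
  show ?case
  proof (cases k)
    case 0
    have "A 0 \<omega> = A0" if "\<omega> \<in> space (?F 0)" for \<omega>
      using alg that by (simp add: midas_ll1_def space_history)
    then have "A 0 \<in> borel_measurable (?F 0) \<longleftrightarrow> (\<lambda>_. A0) \<in> borel_measurable (?F 0)"
      by (rule measurable_cong)
    then show ?thesis by (simp add: 0)
  next
    case (Suc l)
    have A: "A j \<in> borel_measurable (?F (Suc l))" if "j \<le> l" for j
      using that Suc by (intro measurable_from_subalg[OF subalgebra_history_mono less]) auto
    have G: "G l \<in> borel_measurable (?F (Suc l))"
      using alg by (simp add: midas_ll1_def)
    \<comment> \<open>For each piece, one Borel map that does not depend on the sample point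
      produces every minimiser from its data.\<close>
    define P where "P n r p \<longleftrightarrow> p \<in> borel_measurable borel \<and> (\<forall>g z y. is_arg_min
        (\<lambda>Y. h n r Y + ereal (g \<bullet> (Y - z) + 1 / (2 * \<eta> l) * (norm (Y - z))\<^sup>2))
        (\<lambda>Y. Y \<in> piece_space q n r) y \<longrightarrow> y = p ((2 * (1 / (2 * \<eta> l))) *\<^sub>R z - g))" for n r p
    define p where "p n r = (SOME p. P n r p)" for n r
    have "\<exists>p. P n r p" for n r
      using argmin_measurable[OF reg subspace_imp_convex[OF subspace_piece_space], of "1 / (2 * \<eta> l)" n r] \<eta>[of l]
      unfolding P_def Bex_def by simp
    then have P: "P n r (p n r)" for n r
      unfolding p_def by (rule someI_ex)
    have p1: "p n r \<in> borel_measurable borel" for n r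
      using P[of n r] by (simp only: P_def)
    have p2: "y = p n r ((2 * (1 / (2 * \<eta> l))) *\<^sub>R z - g)"
      if "is_arg_min (\<lambda>Y. h n r Y + ereal (g \<bullet> (Y - z) + 1 / (2 * \<eta> l) * (norm (Y - z))\<^sup>2))
        (\<lambda>Y. Y \<in> piece_space q n r) y" for n r g z y
      using P[of n r] that unfolding P_def by blast
    define xt where "xt \<omega> = extrapolate t \<alpha> (\<lambda>j. A j \<omega>) l" for \<omega>
    \<comment> \<open>Here \<open>n\<close> stands for the sampled mode. Measurability is shown for
      each fixed \<open>n\<close> before the random \<open>\<xi> l\<close> is put in.\<close>
    define H where "H n m r \<omega> = (if m = n
        then p m r ((2 * (1 / (2 * \<eta> l))) *\<^sub>R piece q m r (xt \<omega>) - piece q m r (G l \<omega>))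
        else piece q m r (A l \<omega>))" for n m r \<omega>
    have piece: "piece q m r (A (Suc l) \<omega>) = H (\<xi> l \<omega>) m r \<omega>" if \<omega>: "\<omega> \<in> space M" for m r \<omega>
    proof (cases "m = \<xi> l \<omega>")
      case True
      have "is_arg_min (\<lambda>Y. h m r Y + ereal (piece q m r (G l \<omega>) \<bullet> (Y - piece q m r (xt \<omega>))
            + 1 / (2 * \<eta> l) * (norm (Y - piece q m r (xt \<omega>)))\<^sup>2))
          (\<lambda>Y. Y \<in> piece_space q m r) (piece q m r (A (Suc l) \<omega>))"
        using alg \<omega> unfolding midas_ll1_def Let_def True xt_def by blast
      from p2[OF this] show ?thesis
        by (simp add: H_def True)
    next
      case False
      then have "block m (A (Suc l) \<omega>) = block m (A l \<omega>)"
        using alg \<omega> unfolding midas_ll1_def by blast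
      then have "piece q m r (A (Suc l) \<omega>) = piece q m r (A l \<omega>)"
        using piece_block[of q m r "A (Suc l) \<omega>"] piece_block[of q m r "A l \<omega>"] by simp
      then show ?thesis using False by (simp add: H_def)
    qed
    have "A (Suc l) \<omega> = (\<Sum>m\<in>UNIV. \<Sum>r\<in>UNIV. H (\<xi> l \<omega>) m r \<omega>)" if "\<omega> \<in> space (?F (Suc l))" for \<omega>
    proof -
      have "A (Suc l) \<omega> = (\<Sum>m\<in>UNIV. \<Sum>r\<in>UNIV. piece q m r (A (Suc l) \<omega>))"
        by (simp only: sum_piece sum_block)
      then show ?thesis
        using that by (simp only: space_history piece)
    qed
    then have cong: "A (Suc l) \<in> borel_measurable (?F (Suc l)) \<longleftrightarrow>
        (\<lambda>\<omega>. \<Sum>m\<in>UNIV. \<Sum>r\<in>UNIV. H (\<xi> l \<omega>) m r \<omega>) \<in> borel_measurable (?F (Suc l))"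
      by (rule measurable_cong)
    have lin: "(\<lambda>\<omega>. piece q m r (f \<omega>)) \<in> borel_measurable (?F (Suc l))"
      if "f \<in> borel_measurable (?F (Suc l))" for f m r
      using measurable_compose[OF that borel_measurable_linear[OF linear_piece]] .
    have "(\<lambda>\<omega>. p m r ((2 * (1 / (2 * \<eta> l))) *\<^sub>R piece q m r (xt \<omega>) - piece q m r (G l \<omega>)))
        \<in> borel_measurable (?F (Suc l))" for m r
      unfolding xt_def
      by (intro measurable_compose[OF _ p1] borel_measurable_diff borel_measurable_scaleR
          borel_measurable_const lin borel_measurable_extrapolate A G)
    moreover have "(\<lambda>\<omega>. piece q m r (A l \<omega>)) \<in> borel_measurable (?F (Suc l))" for m r
      by (intro lin A order_refl)
    ultimately have "H n m r \<in> borel_measurable (?F (Suc l))" for n m r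
      unfolding H_def[abs_def] by (cases "m = n") (simp_all only: if_True if_False refl)
    then have "(\<lambda>\<omega>. H (\<xi> l \<omega>) m r \<omega>) \<in> borel_measurable (?F (Suc l))" for m r
      by (rule measurable_compose_mode[where f = "\<lambda>n. H n m r", OF measurable_history_block[OF lessI]])
    then show ?thesis
      unfolding Suc cong by (intro borel_measurable_sum)
  qed
qed

lemma borel_measurable_grad_error:
  assumes "\<xi> k \<in> M \<rightarrow>\<^sub>M count_space UNIV" "G k \<in> borel_measurable M"
    and A: "\<And>j. A j \<in> borel_measurable M"
  shows "grad_error \<xi> q X t \<beta> G A k \<in> borel_measurable M"
proof -
  have block: "(\<lambda>\<omega>. block n (f \<omega>)) \<in> borel_measurable M" if "f \<in> borel_measurable M" for f n
    using measurable_compose[OF that borel_measurable_linear[OF linear_block]] .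
  have grad: "(\<lambda>\<omega>. block_grad q X n (f \<omega>)) \<in> borel_measurable M" if "f \<in> borel_measurable M" for f n
    unfolding block_grad_def
    by (intro block measurable_compose[OF that borel_measurable_grad[OF fit_differentiable]])
  have "(\<lambda>\<omega>. norm (block n (G k \<omega>) - block_grad q X n
      (replace_block n (A k \<omega>) (extrapolate t \<beta> (\<lambda>j. A j \<omega>) k)))) \<in> borel_measurable M" for n
    unfolding replace_block_def
    by (intro measurable_compose[OF _ borel_measurable_norm] block grad
        borel_measurable_add borel_measurable_diff borel_measurable_extrapolate assms)
  from measurable_compose_mode[OF assms(1) this] show ?thesis
    unfolding grad_error_def[abs_def] .
qed

section \<open>Conditional expectations of extended real functions\<close>

lemma e2ennreal_add:
  assumes "0 \<le> x" "0 \<le> y"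
  shows "e2ennreal (x + y) = e2ennreal x + e2ennreal y"
proof -
  have "x + y = enn2ereal (e2ennreal x + e2ennreal y)"
    using assms by (simp add: plus_ennreal.rep_eq enn2ereal_e2ennreal)
  then show ?thesis by simp
qed

text \<open>Turns a balance of nonnegative quantities back into one with subtractions. Only
  \<open>p\<close> and \<open>n\<close> may be infinite, and they are so together.\<close>

lemma ennreal_cancel_parts:
  assumes "p + gm = wm + n + gp" "wm \<noteq> \<infinity>" "gm \<noteq> \<infinity>" "gp \<noteq> \<infinity>"
  shows "enn2ereal p - enn2ereal wm = enn2ereal n + ereal (enn2real gp - enn2real gm)"
proof -
  obtain g1 g2 g3 where g: "wm = ennreal g1" "gm = ennreal g2" "gp = ennreal g3" "0 \<le> g1" "0 \<le> g2" "0 \<le> g3"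
    using assms(2-4) by (cases wm; cases gm; cases gp) auto
  show ?thesis
  proof (cases n)
    case (real n')
    have "p + gm = ennreal (g1 + n' + g3)"
      using assms(1) g real by simp
    then have "p \<noteq> \<infinity>"
      by (cases "p = \<infinity>") auto
    then obtain p' where p: "p = ennreal p'" "0 \<le> p'"
      by (cases p) auto
    have "ennreal (p' + g2) = ennreal (g1 + n' + g3)"
      using assms(1) by (simp add: g real p)
    then have "p' + g2 = g1 + n' + g3"
      using g p real by (subst (asm) ennreal_inj) auto
    then show ?thesis
      using g p real by (simp add: enn2ereal_ennreal)
  next
    case top
    then have "p + gm = \<infinity>" using assms(1) by simp
    then have "p = \<infinity>" using assms(3) by auto
    then show ?thesis using top g by (simp add: enn2ereal_ennreal)
  qed
qed

text \<open>Equality of positive minus negative parts, with all subtractions moved to the other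
  side: it then makes sense for \<open>n = \<infinity>\<close> and can be conditioned term by
  term.\<close>

lemma e2ennreal_parts:
  assumes "W = enn2ereal n + ereal g"
  shows "e2ennreal W + ennreal (- g) = e2ennreal (- W) + n + ennreal g"
proof (cases n)
  case (real r)
  then have W: "W = ereal (r + g)" using assms by (simp add: enn2ereal_ennreal)
  have "ennreal (r + g) + ennreal (- g) = ennreal (- (r + g)) + ennreal r + ennreal g"
  proof (cases "0 \<le> g")
    case True
    then show ?thesis using real by (simp add: ennreal_neg)
  next
    case False
    show ?thesis
    proof (cases "0 \<le> r + g")
      case True
      then show ?thesis using False real
        by (simp add: ennreal_neg flip: ennreal_plus)
    next
      case False' : False
      then show ?thesis using False real
        by (simp add: ennreal_neg flip: ennreal_plus)
    qed
  qed
  then show ?thesis by (simp add: W real e2ennreal_ereal)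
next
  case top
  then show ?thesis using assms by simp
qed

section \<open>Conditioning a nonnegative plus an integrable function\<close>

context finite_measure_subalgebra
begin

lemma nn_cond_exp_finite:
  assumes "f \<in> borel_measurable M" "(\<integral>\<^sup>+ x. f x \<partial>M) \<noteq> \<infinity>"
  shows "AE x in M. nn_cond_exp M F f x \<noteq> \<infinity>"
proof (rule nn_integral_PInf_AE)
  have "(\<integral>\<^sup>+ x. nn_cond_exp M F f x \<partial>M) = (\<integral>\<^sup>+ x. f x \<partial>M)"
    using nn_cond_exp_intg[of "\<lambda>_. 1" f] assms(1) by simp
  with assms(2) show "(\<integral>\<^sup>+ x. nn_cond_exp M F f x \<partial>M) \<noteq> \<infinity>" by simp
qed simp

lemma nn_cond_exp_const: "AE x in M. nn_cond_exp M F (\<lambda>_. c) x = c"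
  using nn_cond_exp_F_meas[of "\<lambda>_. c"] by auto

lemma nn_cond_exp_cmult:
  assumes "f \<in> borel_measurable M"
  shows "AE x in M. nn_cond_exp M F (\<lambda>x. c * f x) x = c * nn_cond_exp M F f x"
  using nn_cond_exp_prod[of "\<lambda>_. c" f] assms by auto

text \<open>Tailored to the Lyapunov sequence: \<open>N\<close> will hold the shifted objective with
  the increments, \<open>g\<close> the integrable variance term. The balance of parts is conditioned
  term by term and then turned back pointwise.\<close>

lemma ereal_cond_exp_nonneg_plus_integrable:
  fixes W :: "'a \<Rightarrow> ereal"
  assumes N: "N \<in> borel_measurable M" and g: "integrable M g"
    and W: "\<And>x. x \<in> space M \<Longrightarrow> W x = enn2ereal (N x) + ereal (g x)"
  shows "AE x in M. ereal_cond_exp M F W x = enn2ereal (nn_cond_exp M F N x) + ereal (real_cond_exp M F g x)"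
proof -
  have gm: "g \<in> borel_measurable M" using g by simp
  have "W \<in> borel_measurable M \<longleftrightarrow> (\<lambda>x. enn2ereal (N x) + ereal (g x)) \<in> borel_measurable M"
    by (rule measurable_cong) (rule W)
  then have Wm: "W \<in> borel_measurable M"
    using N gm by simp
  define Wp Wn gp gn where "Wp x = e2ennreal (W x)" and "Wn x = e2ennreal (- W x)"
    and "gp x = ennreal (g x)" and "gn x = ennreal (- g x)" for x
  have meas: "Wp \<in> borel_measurable M" "Wn \<in> borel_measurable M" "gp \<in> borel_measurable M" "gn \<in> borel_measurable M"
    unfolding Wp_def[abs_def] Wn_def[abs_def] gp_def[abs_def] gn_def[abs_def] using Wm gm by measurable
  have eq: "AE x in M. Wp x + gn x = Wn x + N x + gp x"
    using e2ennreal_parts[OF W] by (auto simp: Wp_def Wn_def gp_def gn_def)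
  \<comment> \<open>As \<open>N\<close> is nonnegative, the negative part of \<open>W\<close> is at
    most that of \<open>g\<close>; hence its conditional expectation is finite and may be
    subtracted.\<close>
  have le: "AE x in M. Wn x \<le> gn x"
  proof (rule AE_I2)
    fix x assume "x \<in> space M"
    then have "ereal (g x) \<le> W x"
      by (simp add: W enn2ereal_nonneg add_increasing)
    then have "- W x \<le> ereal (- g x)"
      by (metis ereal_minus_le_minus uminus_ereal.simps(1))
    then have "e2ennreal (- W x) \<le> e2ennreal (ereal (- g x))"
      by (rule e2ennreal_mono)
    then show "Wn x \<le> gn x" by (simp add: Wn_def gn_def e2ennreal_ereal)
  qed
  have fin: "AE x in M. nn_cond_exp M F gp x \<noteq> \<infinity>" "AE x in M. nn_cond_exp M F gn x \<noteq> \<infinity>"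
    using g unfolding real_integrable_def
    by (intro nn_cond_exp_finite meas; simp add: gp_def gn_def)+
  have "AE x in M. nn_cond_exp M F (\<lambda>x. Wp x + gn x) x = nn_cond_exp M F (\<lambda>x. Wn x + N x + gp x) x"
    using meas N by (intro nn_cond_exp_cong eq) auto
  moreover have "AE x in M. nn_cond_exp M F Wp x + nn_cond_exp M F gn x = nn_cond_exp M F (\<lambda>x. Wp x + gn x) x"
    using meas N by (intro nn_cond_exp_sum) auto
  moreover have "AE x in M. nn_cond_exp M F (\<lambda>x. Wn x + N x) x + nn_cond_exp M F gp x = nn_cond_exp M F (\<lambda>x. Wn x + N x + gp x) x"
    using meas N by (intro nn_cond_exp_sum) auto
  moreover have "AE x in M. nn_cond_exp M F Wn x + nn_cond_exp M F N x = nn_cond_exp M F (\<lambda>x. Wn x + N x) x"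
    using meas N by (intro nn_cond_exp_sum) auto
  moreover have "AE x in M. nn_cond_exp M F Wn x \<le> nn_cond_exp M F gn x"
    using meas by (intro nn_cond_exp_mono le) auto
  ultimately show ?thesis
    using fin
  proof eventually_elim
    case (elim x)
    have "nn_cond_exp M F Wn x \<noteq> \<infinity>"
      using elim(5,7) by (auto simp: top_unique)
    moreover have "nn_cond_exp M F Wp x + nn_cond_exp M F gn x
        = nn_cond_exp M F Wn x + nn_cond_exp M F N x + nn_cond_exp M F gp x"
      using elim by simp
    ultimately have "enn2ereal (nn_cond_exp M F Wp x) - enn2ereal (nn_cond_exp M F Wn x)
        = enn2ereal (nn_cond_exp M F N x)
          + ereal (enn2real (nn_cond_exp M F gp x) - enn2real (nn_cond_exp M F gn x))"
      using elim by (intro ennreal_cancel_parts)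
    then show ?case
      by (simp add: ereal_cond_exp_def real_cond_exp_def Wp_def[abs_def] Wn_def[abs_def] gp_def[abs_def] gn_def[abs_def])
  qed
qed

lemma ereal_cond_exp_integrable:
  assumes "integrable M g"
  shows "AE x in M. ereal_cond_exp M F (\<lambda>x. ereal (g x)) x = ereal (real_cond_exp M F g x)"
proof -
  have "AE x in M. ereal_cond_exp M F (\<lambda>x. ereal (g x)) x
      = enn2ereal (nn_cond_exp M F (\<lambda>_. 0) x) + ereal (real_cond_exp M F g x)"
    using assms by (intro ereal_cond_exp_nonneg_plus_integrable) (auto simp: zero_ennreal.rep_eq)
  with nn_cond_exp_const[of 0] show ?thesis
    by eventually_elim (simp add: zero_ennreal.rep_eq)
qed

lemma ereal_cond_exp_nonneg:
  assumes "f \<in> borel_measurable M" "\<And>x. 0 \<le> f x"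
  shows "AE x in M. ereal_cond_exp M F (\<lambda>x. ereal (f x)) x = enn2ereal (nn_cond_exp M F (\<lambda>x. ennreal (f x)) x)"
proof -
  have "AE x in M. ereal_cond_exp M F (\<lambda>x. ereal (f x)) x
      = enn2ereal (nn_cond_exp M F (\<lambda>x. ennreal (f x)) x) + ereal (real_cond_exp M F (\<lambda>_. 0) x)"
    using assms by (intro ereal_cond_exp_nonneg_plus_integrable) (auto simp: enn2ereal_ennreal)
  moreover have "AE x in M. real_cond_exp M F (\<lambda>_. 0) x = 0"
    by (intro real_cond_exp_F_meas) auto
  ultimately show ?thesis
    by eventually_elim (simp flip: zero_ereal_def)
qed

lemma real_cond_exp_affine:
  assumes "integrable M g"
  shows "AE x in M. real_cond_exp M F (\<lambda>x. c + s * g x) x = c + s * real_cond_exp M F g x"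
proof -
  have "AE x in M. real_cond_exp M F (\<lambda>x. c + s * g x) x = real_cond_exp M F (\<lambda>_. c) x + real_cond_exp M F (\<lambda>x. s * g x) x"
    using assms by (intro real_cond_exp_add) auto
  moreover have "AE x in M. real_cond_exp M F (\<lambda>x. s * g x) x = s * real_cond_exp M F g x"
    using assms by (intro real_cond_exp_cmult)
  moreover have "AE x in M. real_cond_exp M F (\<lambda>_. c) x = c"
    by (intro real_cond_exp_F_meas) auto
  ultimately show ?thesis by eventually_elim simp
qed

end

section \<open>Descent of the Lyapunov sequence\<close>

text \<open>The total coefficient of the \<open>i\<close>-th squared increment in the Lyapunov
  sequence; at \<open>1\<close> it is the sum subtracted in \<open>\<delta>\<close>.\<close>

definition lyapunov_weight :: "nat \<Rightarrow> (nat \<Rightarrow> real) \<Rightarrow> nat \<Rightarrow> real" where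
  "lyapunov_weight t a i = (\<Sum>j=i..t+1. real (j + 1) * a j)"

lemma lyapunov_weight_Suc:
  "i \<le> t + 1 \<Longrightarrow> lyapunov_weight t a i = real (i + 1) * a i + lyapunov_weight t a (i + 1)"
  unfolding lyapunov_weight_def by (simp add: sum.atLeast_Suc_atMost del: sum.cl_ivl_Suc)

lemma lyapunov_eq_real:
  assumes "\<And>j. j \<in> {1..t+1} \<Longrightarrow> a j = ereal (a' j)"
  shows "lyapunov q X h t a \<tau> \<gamma> A \<Gamma> k \<omega> = obj q X h (A k \<omega>)
    + ereal (\<Sum>i=1..t+1. lyapunov_weight t a' i * (norm (A (k + 1 - i) \<omega> - A (k - i) \<omega>))\<^sup>2)
    + ereal (1 / (2 * \<tau> * \<gamma>) * \<Gamma> k \<omega>)"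
proof -
  have "(\<Sum>j=i..t+1. ereal (real (j + 1)) * a j * ereal V) = ereal (lyapunov_weight t a' i * V)"
    if "i \<in> {1..t+1}" for i V
  proof -
    have "(\<Sum>j=i..t+1. ereal (real (j + 1)) * a j * ereal V) = (\<Sum>j=i..t+1. ereal (real (j + 1) * a' j * V))"
      using that assms by (intro sum.cong) auto
    then show ?thesis
      by (simp only: lyapunov_weight_def sum_distrib_right sum_ereal)
  qed
  then have "(\<Sum>i=1..t+1. \<Sum>j=i..t+1. ereal (real (j + 1)) * a j * ereal (V i))
      = (\<Sum>i=1..t+1. ereal (lyapunov_weight t a' i * V i))" for V
    by (intro sum.cong refl)
  then show ?thesis
    unfolding lyapunov_def by (simp only: sum_ereal)
qed

text \<open>At the next iteration the newest increment enters with index \<open>1\<close>, every old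
  one moves up by one index, and the one with index \<open>t + 1\<close> drops out.\<close>

lemma lyapunov_weight_sum_next:
  fixes A :: "nat \<Rightarrow> 'a::real_normed_vector"
  shows "(\<Sum>i=1..t+1. w i * (norm (A (k + 1 + 1 - i) - A (k + 1 - i)))\<^sup>2)
    = w 1 * (norm (A (Suc k) - A k))\<^sup>2 + (\<Sum>i=1..t. w (i + 1) * (norm (A (k + 1 - i) - A (k - i)))\<^sup>2)"
proof -
  have "(\<Sum>i=1..t+1. f i) = f 1 + (\<Sum>i=1..t. f (i + 1))" for f :: "nat \<Rightarrow> real"
    by (simp add: sum.atLeast_Suc_atMost sum.shift_bounds_cl_Suc_ivl del: sum.cl_ivl_Suc)
  from this[of "\<lambda>i. w i * (norm (A (k + 1 + 1 - i) - A (k + 1 - i)))\<^sup>2"] show ?thesis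
    by simp
qed

text \<open>Moving up by one index costs an increment \<open>real (i + 1) * a i\<close> of its
  weight, which pays for the descent error \<open>s i\<close> and for \<open>\<rho>\<close>; the
  terms \<open>\<gamma> / 2\<close> cancel for \<open>i \<le> t\<close>.\<close>

lemma lyapunov_weight_dissipation:
  fixes V :: "nat \<Rightarrow> real"
  assumes V: "\<And>i. 0 \<le> V i" and a: "\<And>i. i \<in> {1..t} \<Longrightarrow> s i \<le> a i" "\<And>i. i \<in> {1..t} \<Longrightarrow> 0 \<le> a i"
    and \<rho>: "\<rho> \<le> real (t + 2) * a (t + 1) - \<gamma> / 2" "\<And>i. i \<in> {1..t} \<Longrightarrow> \<rho> \<le> a i"
  shows "(\<Sum>i=1..t. (lyapunov_weight t a (i + 1) + s i - \<gamma> / 2) * V i) + \<gamma> / 2 * (\<Sum>i=1..t+1. V i)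
    \<le> (\<Sum>i=1..t+1. lyapunov_weight t a i * V i) - \<rho> * (\<Sum>i=1..t+1. V i)"
proof -
  have "(lyapunov_weight t a (i + 1) + s i - \<gamma> / 2) * V i + \<gamma> / 2 * V i + \<rho> * V i \<le> lyapunov_weight t a i * V i"
    if i: "i \<in> {1..t}" for i
  proof -
    \<comment> \<open>The loss of weight is thus at least \<open>2 * a i\<close>: one copy covers
      \<open>s i\<close>, the other \<open>\<rho>\<close>.\<close>
    have "a i \<le> real i * a i"
      using i a(2)[OF i] by (simp add: mult_le_cancel_right1)
    then have "lyapunov_weight t a (i + 1) + s i + \<rho> \<le> lyapunov_weight t a i"
      using i a(1)[OF i] \<rho>(2)[OF i] lyapunov_weight_Suc[of i t a] by (simp add: ring_distribs)
    from mult_right_mono[OF this V[of i]] show ?thesis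
      by (simp add: algebra_simps)
  qed
  then have "(\<Sum>i=1..t. (lyapunov_weight t a (i + 1) + s i - \<gamma> / 2) * V i + \<gamma> / 2 * V i + \<rho> * V i)
      \<le> (\<Sum>i=1..t. lyapunov_weight t a i * V i)"
    by (intro sum_mono)
  then have "(\<Sum>i=1..t. (lyapunov_weight t a (i + 1) + s i - \<gamma> / 2) * V i)
      + \<gamma> / 2 * (\<Sum>i=1..t. V i) + \<rho> * (\<Sum>i=1..t. V i) \<le> (\<Sum>i=1..t. lyapunov_weight t a i * V i)"
    by (simp only: sum.distrib sum_distrib_left)
  \<comment> \<open>The oldest increment drops out, so its whole weight
    \<open>real (t + 2) * a (t + 1)\<close> is available for \<open>\<gamma> / 2\<close> and
    \<open>\<rho>\<close>.\<close>
  moreover have "\<gamma> / 2 * V (t + 1) + \<rho> * V (t + 1) \<le> lyapunov_weight t a (t + 1) * V (t + 1)"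
    using mult_right_mono[OF \<rho>(1) V[of "t + 1"]] by (simp add: lyapunov_weight_def algebra_simps)
  moreover have split: "(\<Sum>i=1..t+1. f i) = (\<Sum>i=1..t. f i) + f (t + 1)" for f :: "nat \<Rightarrow> real"
    by simp
  ultimately show ?thesis
    unfolding split distrib_left by linarith
qed

text \<open>The factor \<open>1 / (2 * \<tau> * \<gamma>)\<close> is the one for which the
  contraction of \<open>\<Gamma>\<close> exactly absorbs \<open>\<Gamma> / (2 * \<gamma>)\<close>
  from the gradient error, and the value of \<open>\<gamma>\<close> turns the accompanying multiple
  of \<open>S\<close> into \<open>\<gamma> / 2 * S\<close>.\<close>

lemma lyapunov_bound_real:
  fixes n :: real
  assumes "0 < \<tau>" "0 < \<gamma>" "\<gamma>\<^sup>2 = V\<Gamma> / \<tau> + V1"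
    and "n + \<delta> * D \<le> F + Q - c + e / (2 * \<gamma>)"
    and e: "e \<le> \<Gamma> + V1 * S" and \<Gamma>': "\<Gamma>' \<le> (1 - \<tau>) * \<Gamma> + V\<Gamma> * S"
    and "Q + \<gamma> / 2 * S \<le> P - \<rho> * S" "\<rho> \<le> \<delta>" "0 \<le> D"
  shows "n + (c + 1 / (2 * \<tau> * \<gamma>) * \<Gamma>') \<le> F + P + 1 / (2 * \<tau> * \<gamma>) * \<Gamma> - \<rho> * (D + S)"
proof -
  have "e / (2 * \<gamma>) \<le> (\<Gamma> + V1 * S) / (2 * \<gamma>)"
    using e assms(2) by (intro divide_right_mono) auto
  moreover have "1 / (2 * \<tau> * \<gamma>) * \<Gamma>' \<le> 1 / (2 * \<tau> * \<gamma>) * ((1 - \<tau>) * \<Gamma> + V\<Gamma> * S)"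
    using \<Gamma>' assms(1,2) by (intro mult_left_mono) auto
  moreover have "(\<Gamma> + V1 * S) / (2 * \<gamma>) + 1 / (2 * \<tau> * \<gamma>) * ((1 - \<tau>) * \<Gamma> + V\<Gamma> * S)
      = 1 / (2 * \<tau> * \<gamma>) * \<Gamma> + (V\<Gamma> / \<tau> + V1) / (2 * \<gamma>) * S"
    using assms(1,2) by (simp add: field_simps)
  moreover have "(V\<Gamma> / \<tau> + V1) / (2 * \<gamma>) * S = \<gamma> / 2 * S"
    unfolding assms(3)[symmetric] using assms(2) by (simp add: power2_eq_square)
  moreover have "\<rho> * D \<le> \<delta> * D"
    using assms by (intro mult_right_mono)
  ultimately show ?thesis
    using assms(4,7) unfolding distrib_left by linarith
qed

text \<open>If \<open>\<Phi>\<close> is infinite, so is the right side, because \<open>ED\<close> is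
  finite; otherwise \<open>le\<close> forces \<open>EN\<close> to be finite, and the real inequality
  applies.\<close>

lemma lyapunov_bound_cond_exp:
  fixes EN ED Ee U :: ennreal and \<Phi> E\<Gamma> :: ereal
  assumes "0 < \<tau>" "0 < \<gamma>" "\<gamma>\<^sup>2 = V\<Gamma> / \<tau> + V1" "0 \<le> \<delta>"
    and le: "EN + ennreal \<delta> * ED \<le> U + ennreal (1 / (2 * \<gamma>)) * Ee"
    and U: "U = e2ennreal (\<Phi> + ereal (Q - c))" "0 \<le> \<Phi> + ereal (Q - c)"
    and e: "enn2ereal Ee \<le> ereal (\<Gamma> + V1 * S)" and \<Gamma>': "\<Gamma>' \<le> (1 - \<tau>) * \<Gamma> + V\<Gamma> * S"
    and ED: "ED \<noteq> \<infinity>"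
    and "Q + \<gamma> / 2 * S \<le> P - \<rho> * S" "\<rho> \<le> \<delta>"
  shows "enn2ereal EN + ereal (c + 1 / (2 * \<tau> * \<gamma>) * \<Gamma>')
    \<le> \<Phi> + ereal P + ereal (1 / (2 * \<tau> * \<gamma>) * \<Gamma>) - ereal \<rho> * (enn2ereal ED + ereal S)"
proof -
  obtain D where D: "ED = ennreal D" "0 \<le> D"
    using ED by (cases ED) auto
  obtain e' where e': "Ee = ennreal e'" "0 \<le> e'" "e' \<le> \<Gamma> + V1 * S"
    using e by (cases Ee) (auto simp: enn2ereal_ennreal)
  show ?thesis
  proof (cases \<Phi>)
    case (real F)
    then have F: "U = ennreal (F + Q - c)" "0 \<le> F + Q - c"
      using U by (simp_all add: e2ennreal_ereal add_diff_eq)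
    have le': "EN + ennreal (\<delta> * D) \<le> ennreal (F + Q - c + e' / (2 * \<gamma>))"
      using le F e' D assms(2,4) by (simp add: ennreal_mult[symmetric])
    then have "EN \<noteq> \<infinity>"
      by (cases "EN = \<infinity>") (auto simp: top_unique)
    then obtain n where n: "EN = ennreal n" "0 \<le> n"
      by (cases EN) auto
    have "n + \<delta> * D \<le> F + Q - c + e' / (2 * \<gamma>)"
      using le' n D e' F assms(2,4) by (simp flip: ennreal_plus)
    from lyapunov_bound_real[OF assms(1-3) this e'(3) \<Gamma>' assms(11,12) D(2)] show ?thesis
      by (simp add: real n D enn2ereal_ennreal)
  next
    case PInf
    then show ?thesis by (simp add: D enn2ereal_ennreal)
  next
    case MInf
    then show ?thesis using U(2) by simp
  qed
qed

text \<open>The descent at one iteration with real constants; \<open>a_seq\<close> and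
  \<open>b_seq\<close> enter only through bounds at this \<open>k\<close>.\<close>

lemma expected_lyapunov_descent:
  fixes A G :: "nat \<Rightarrow> 'w \<Rightarrow> ('c::finite, 'r::finite, 'i1::finite, 'i2::finite, 'i3::finite) factors"
  assumes M: "prob_space M" and \<eta>: "\<And>k. 0 < \<eta> k" and \<alpha>: "\<And>j. 0 \<le> \<alpha> j"
    and alg: "midas_ll1 M Z \<xi> \<zeta> fib B q h t \<eta> \<alpha> A0 G A"
    and reg: "\<And>n r. proper_lsc_bdd_convex_on (piece_space q n r) (h n r)"
    and bounded: "AE \<omega> in M. \<forall>k. norm (A k \<omega>) \<le> C"
    and lipschitz: "AE \<omega> in M. \<forall>k n Y Y'.
        norm (block_grad q X n (replace_block n (A k \<omega>) Y) - block_grad q X n (replace_block n (A k \<omega>) Y'))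
          \<le> L * norm (block n Y - block n Y')"
    and est: "variance_reduced M Z \<xi> \<zeta> q X t \<beta> G A V1 V2 V\<Gamma> \<tau> \<Gamma> \<Upsilon>"
    and \<gamma>: "0 < \<gamma>" "\<gamma>\<^sup>2 = V\<Gamma> / \<tau> + V1" and L: "0 \<le> L"
    and a: "\<And>j. j \<in> {1..t+1} \<Longrightarrow> a j = ereal (a' j)" "\<And>j. j \<in> {1..t+1} \<Longrightarrow> 0 \<le> a' j"
    and a_seq: "\<And>i. i \<in> {1..t} \<Longrightarrow> a_seq t \<eta> \<alpha> \<beta> L \<gamma> k i \<le> a' i"
    and b_seq: "lyapunov_weight t a' 1 + \<delta> \<le> b_seq t \<eta> \<alpha> L \<gamma> k" and \<delta>: "0 \<le> \<delta>"
    and \<rho>: "\<rho> \<le> \<delta>" "\<rho> \<le> real (t + 2) * a' (t + 1) - \<gamma> / 2" "\<And>i. i \<in> {1..t} \<Longrightarrow> \<rho> \<le> a' i"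
  shows "AE \<omega> in M.
    ereal_cond_exp M (history M Z \<xi> \<zeta> k) (lyapunov q X h t a \<tau> \<gamma> A \<Gamma> (k + 1)) \<omega>
    \<le> lyapunov q X h t a \<tau> \<gamma> A \<Gamma> k \<omega>
      - ereal \<rho> * (ereal_cond_exp M (history M Z \<xi> \<zeta> k)
                (\<lambda>\<omega>. ereal ((norm (A (k + 1) \<omega> - A k \<omega>))\<^sup>2)) \<omega>
             + ereal (\<Sum>i=1..t+1. (norm (A (k + 1 - i) \<omega> - A (k - i) \<omega>))\<^sup>2))"
proof -
  interpret M: prob_space M by (rule M)
  define F where "F = history M Z \<xi> \<zeta> k"
  have \<xi>: "\<And>j. \<xi> j \<in> M \<rightarrow>\<^sub>M count_space UNIV" and \<zeta>: "\<And>j. \<zeta> j \<in> M \<rightarrow>\<^sub>M Z"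
    using alg by (simp_all add: midas_ll1_def)
  have sub: "subalgebra M (history M Z \<xi> \<zeta> j)" for j
    by (rule subalgebra_history[OF \<xi> \<zeta>])
  interpret finite_measure_subalgebra M F
    unfolding F_def by unfold_locales (rule sub)
  have \<tau>: "0 < \<tau>" and \<Gamma>: "integrable M (\<Gamma> (k + 1))"
    and est1: "AE \<omega> in M. ereal_cond_exp M F (\<lambda>\<omega>. ereal ((grad_error \<xi> q X t \<beta> G A k \<omega>)\<^sup>2)) \<omega>
      \<le> ereal (\<Gamma> k \<omega> + V1 * (\<Sum>i=1..t+1. (norm (A (k + 1 - i) \<omega> - A (k - i) \<omega>))\<^sup>2))"
    and est2: "AE \<omega> in M. ereal_cond_exp M F (\<lambda>\<omega>. ereal (\<Gamma> (k + 1) \<omega>)) \<omega>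
      \<le> ereal ((1 - \<tau>) * \<Gamma> k \<omega> + V\<Gamma> * (\<Sum>i=1..t+1. (norm (A (k + 1 - i) \<omega> - A (k - i) \<omega>))\<^sup>2))"
    using est unfolding variance_reduced_def F_def by auto
  have AF: "A j \<in> borel_measurable F" if "j \<le> k" for j
    unfolding F_def using that
    by (rule measurable_from_subalg[OF subalgebra_history_mono measurable_iterates[OF alg reg \<eta>]])
  have AM: "A j \<in> borel_measurable M" for j
    by (rule measurable_from_subalg[OF sub measurable_iterates[OF alg reg \<eta>]])
  have GM: "G k \<in> borel_measurable M"
    using alg by (intro measurable_from_subalg[OF sub]) (auto simp: midas_ll1_def)

  obtain c where c: "\<And>A. ereal c \<le> obj q X h A"
    using obj_lower_bound[OF reg] by blast
  define w where "w = lyapunov_weight t a'"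
  have w: "0 \<le> w i" if "1 \<le> i" for i
    unfolding w_def lyapunov_weight_def using that a(2) by (intro sum_nonneg) auto
  define s where "s i = a_seq t \<eta> \<alpha> \<beta> L \<gamma> k i - \<gamma> / 2" for i
  have s: "0 \<le> s i" for i
    unfolding s_def a_seq_def using L \<alpha> \<eta>[of k] by (simp add: less_imp_le)
  define D V where "D \<omega> = (norm (A (k + 1) \<omega> - A k \<omega>))\<^sup>2"
    and "V i \<omega> = (norm (A (k + 1 - i) \<omega> - A (k - i) \<omega>))\<^sup>2" for \<omega> i
  define e where "e \<omega> = (grad_error \<xi> q X t \<beta> G A k \<omega>)\<^sup>2" for \<omega>
  \<comment> \<open>\<open>P'\<close> and \<open>P\<close> are the weighted increments in the
    Lyapunov sequence at \<open>k + 1\<close> and at \<open>k\<close>. \<open>Q\<close> collects the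
    old part of \<open>P'\<close> and the inertial errors of the step.\<close>
  define P' where "P' \<omega> = w 1 * D \<omega> + (\<Sum>i=1..t. w (i + 1) * V i \<omega>)" for \<omega>
  define P where "P \<omega> = (\<Sum>i=1..t+1. w i * V i \<omega>)" for \<omega>
  define Q where "Q \<omega> = (\<Sum>i=1..t. (w (i + 1) + s i) * V i \<omega>)" for \<omega>
  have D0: "0 \<le> D \<omega>" and V0: "0 \<le> V i \<omega>" for \<omega> i
    by (simp_all add: D_def V_def)
  have P'0: "0 \<le> P' \<omega>" and Q0: "0 \<le> Q \<omega>" for \<omega>
    unfolding P'_def Q_def using D0 V0 w s
    by (auto intro!: sum_nonneg add_nonneg_nonneg mult_nonneg_nonneg)
  \<comment> \<open>Subtracting \<open>c\<close> leaves both sums nonnegative, so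
    \<open>e2ennreal\<close> cuts nothing off.\<close>
  define N where "N \<omega> = e2ennreal (obj q X h (A (k + 1) \<omega>) + ereal (P' \<omega> - c))" for \<omega>
  define U where "U \<omega> = e2ennreal (obj q X h (A k \<omega>) + ereal (Q \<omega> - c))" for \<omega>
  have nonneg: "0 \<le> obj q X h x + ereal (p - c)" if "0 \<le> p" for x p
    using c[of x] that by (cases "obj q X h x") auto

  have objF: "(\<lambda>\<omega>. obj q X h (A k \<omega>)) \<in> borel_measurable F"
    by (rule measurable_compose[OF AF borel_measurable_obj[OF reg]]) simp
  have objM: "(\<lambda>\<omega>. obj q X h (A j \<omega>)) \<in> borel_measurable M" for j
    by (rule measurable_compose[OF AM borel_measurable_obj[OF reg]])
  have VF: "V i \<in> borel_measurable F" if "i \<in> {1..t+1}" for i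
  proof -
    \<comment> \<open>As \<open>i\<close> is at least \<open>1\<close>, only iterates up to
      \<open>k\<close> occur, and these are known to the history.\<close>
    have "k + 1 - i \<le> k" "k - i \<le> k" using that by auto
    from this[THEN AF] show ?thesis unfolding V_def[abs_def] by measurable
  qed
  have VM: "V i \<in> borel_measurable M" and DM: "D \<in> borel_measurable M" for i
    unfolding V_def[abs_def] D_def[abs_def] using AM by measurable
  have eM: "e \<in> borel_measurable M"
    unfolding e_def[abs_def] using borel_measurable_grad_error[of \<xi> k M G A, OF \<xi> GM AM] by measurable
  have QF: "Q \<in> borel_measurable F"
    unfolding Q_def[abs_def] using VF by (intro borel_measurable_sum borel_measurable_times) auto
  have UF: "U \<in> borel_measurable F"
    unfolding U_def[abs_def] using objF QF by measurable
  then have UM: "U \<in> borel_measurable M"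
    by (rule measurable_from_subalg[OF subalg])
  have NM: "N \<in> borel_measurable M"
    unfolding N_def[abs_def] P'_def[abs_def] using objM VM DM by measurable

  note [measurable] = NM DM UM eM
  \<comment> \<open>\<open>P' - c\<close> and \<open>\<delta> * D\<close> are added to both sides of
    the pathwise descent. The new increment disappears on the right because \<open>b_seq\<close>
    exceeds its weight \<open>w 1\<close> by at least \<open>\<delta>\<close>. All terms are now
    nonnegative.\<close>
  have path: "AE \<omega> in M. N \<omega> + ennreal \<delta> * ennreal (D \<omega>) \<le> U \<omega> + ennreal (1 / (2 * \<gamma>)) * ennreal (e \<omega>)"
    using lipschitz AE_space
  proof eventually_elim
    case (elim \<omega>)
    have D': "D \<omega> = (norm (A (Suc k) \<omega> - A k \<omega>))\<^sup>2"
      by (simp add: D_def)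
    have "obj q X h (A (Suc k) \<omega>) \<le> obj q X h (A k \<omega>)
      + ereal (e \<omega> / (2 * \<gamma>) - b_seq t \<eta> \<alpha> L \<gamma> k * D \<omega> + (\<Sum>i=1..t. s i * V i \<omega>))"
      unfolding e_def grad_error_def D' V_def s_def
      by (rule midas_step_descent[where A = "\<lambda>j. A j \<omega>" and n = "\<xi> k \<omega>" and q = q and h = h and g = "G k \<omega>"])
        (use alg elim \<gamma> \<eta> \<alpha> in \<open>auto simp: midas_ll1_def\<close>)
    then have step: "obj q X h (A (k + 1) \<omega>) \<le> obj q X h (A k \<omega>)
      + ereal (e \<omega> / (2 * \<gamma>) - b_seq t \<eta> \<alpha> L \<gamma> k * D \<omega> + (\<Sum>i=1..t. s i * V i \<omega>))"
      by (simp only: Suc_eq_plus1)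
    have "(lyapunov_weight t a' 1 + \<delta>) * D \<omega> \<le> b_seq t \<eta> \<alpha> L \<gamma> k * D \<omega>"
      using b_seq D0 by (intro mult_right_mono)
    then have "e \<omega> / (2 * \<gamma>) - b_seq t \<eta> \<alpha> L \<gamma> k * D \<omega> + (\<Sum>i=1..t. s i * V i \<omega>) + (P' \<omega> - c) + \<delta> * D \<omega>
        \<le> Q \<omega> - c + e \<omega> / (2 * \<gamma>)"
      unfolding P'_def Q_def w_def by (simp add: distrib_right sum.distrib)
    with step have *: "obj q X h (A (k + 1) \<omega>) + ereal (P' \<omega> - c) + ereal (\<delta> * D \<omega>)
        \<le> obj q X h (A k \<omega>) + ereal (Q \<omega> - c) + ereal (e \<omega> / (2 * \<gamma>))"
      by (cases "obj q X h (A (k + 1) \<omega>)"; cases "obj q X h (A k \<omega>)") auto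
    have "N \<omega> + ennreal (\<delta> * D \<omega>) = e2ennreal (obj q X h (A (k + 1) \<omega>) + ereal (P' \<omega> - c) + ereal (\<delta> * D \<omega>))"
      using nonneg[OF P'0] \<delta> D0 unfolding N_def e2ennreal_ereal[symmetric]
      by (intro e2ennreal_add[symmetric]) simp_all
    also have "\<dots> \<le> e2ennreal (obj q X h (A k \<omega>) + ereal (Q \<omega> - c) + ereal (e \<omega> / (2 * \<gamma>)))"
      by (rule e2ennreal_mono[OF *])
    also have "\<dots> = U \<omega> + ennreal (e \<omega> / (2 * \<gamma>))"
      using nonneg[OF Q0] \<gamma> unfolding U_def e2ennreal_ereal[symmetric]
      by (intro e2ennreal_add) (simp_all add: e_def)
    finally show ?case
      using \<delta> D0[of \<omega>] \<gamma> by (simp add: ennreal_mult[symmetric] e_def)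
  qed

  have "AE \<omega> in M. nn_cond_exp M F (\<lambda>\<omega>. N \<omega> + ennreal \<delta> * ennreal (D \<omega>)) \<omega>
      \<le> nn_cond_exp M F (\<lambda>\<omega>. U \<omega> + ennreal (1 / (2 * \<gamma>)) * ennreal (e \<omega>)) \<omega>"
    by (rule nn_cond_exp_mono[OF path]) simp_all
  moreover have "AE \<omega> in M. nn_cond_exp M F N \<omega> + nn_cond_exp M F (\<lambda>\<omega>. ennreal \<delta> * ennreal (D \<omega>)) \<omega>
      = nn_cond_exp M F (\<lambda>\<omega>. N \<omega> + ennreal \<delta> * ennreal (D \<omega>)) \<omega>"
    by (rule nn_cond_exp_sum) simp_all
  moreover have "AE \<omega> in M. nn_cond_exp M F U \<omega> + nn_cond_exp M F (\<lambda>\<omega>. ennreal (1 / (2 * \<gamma>)) * ennreal (e \<omega>)) \<omega>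
      = nn_cond_exp M F (\<lambda>\<omega>. U \<omega> + ennreal (1 / (2 * \<gamma>)) * ennreal (e \<omega>)) \<omega>"
    by (rule nn_cond_exp_sum) simp_all
  moreover have "AE \<omega> in M. nn_cond_exp M F (\<lambda>\<omega>. ennreal \<delta> * ennreal (D \<omega>)) \<omega> = ennreal \<delta> * nn_cond_exp M F (\<lambda>\<omega>. ennreal (D \<omega>)) \<omega>"
    by (rule nn_cond_exp_cmult) simp
  moreover have "AE \<omega> in M. nn_cond_exp M F (\<lambda>\<omega>. ennreal (1 / (2 * \<gamma>)) * ennreal (e \<omega>)) \<omega>
      = ennreal (1 / (2 * \<gamma>)) * nn_cond_exp M F (\<lambda>\<omega>. ennreal (e \<omega>)) \<omega>"
    by (rule nn_cond_exp_cmult) simp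
  \<comment> \<open>\<open>U\<close> is determined by the history, so conditioning leaves it
    unchanged.\<close>
  moreover have "AE \<omega> in M. U \<omega> = nn_cond_exp M F U \<omega>"
    by (rule nn_cond_exp_F_meas[OF UF])
  ultimately have cond: "AE \<omega> in M. nn_cond_exp M F N \<omega> + ennreal \<delta> * nn_cond_exp M F (\<lambda>\<omega>. ennreal (D \<omega>)) \<omega>
      \<le> U \<omega> + ennreal (1 / (2 * \<gamma>)) * nn_cond_exp M F (\<lambda>\<omega>. ennreal (e \<omega>)) \<omega>"
    by eventually_elim simp

  \<comment> \<open>Boundedness of the iterates keeps the conditional expectation of
    \<open>D\<close> finite, so subtracting \<open>\<rho>\<close> times it never leads to
    \<open>\<infinity> - \<infinity>\<close>.\<close>
  have "AE \<omega> in M. ennreal (D \<omega>) \<le> ennreal ((2 * C)\<^sup>2)"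
    using bounded
  proof eventually_elim
    case (elim \<omega>)
    have "norm (A (k + 1) \<omega> - A k \<omega>) \<le> 2 * C"
      using norm_triangle_ineq4[of "A (k + 1) \<omega>" "A k \<omega>"] elim[rule_format, of "k + 1"] elim[rule_format, of k] by simp
    then show ?case
      unfolding D_def by (intro ennreal_leI power_mono) auto
  qed
  then have "AE \<omega> in M. nn_cond_exp M F (\<lambda>\<omega>. ennreal (D \<omega>)) \<omega> \<le> nn_cond_exp M F (\<lambda>_. ennreal ((2 * C)\<^sup>2)) \<omega>"
    by (rule nn_cond_exp_mono) simp_all
  then have finD: "AE \<omega> in M. nn_cond_exp M F (\<lambda>\<omega>. ennreal (D \<omega>)) \<omega> \<noteq> \<infinity>"
    using nn_cond_exp_const[of "ennreal ((2 * C)\<^sup>2)"] by eventually_elim (auto simp: top_unique)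

  have lyap: "lyapunov q X h t a \<tau> \<gamma> A \<Gamma> j \<omega> = obj q X h (A j \<omega>)
    + ereal (\<Sum>i=1..t+1. lyapunov_weight t a' i * (norm (A (j + 1 - i) \<omega> - A (j - i) \<omega>))\<^sup>2)
    + ereal (1 / (2 * \<tau> * \<gamma>) * \<Gamma> j \<omega>)" for j \<omega>
    by (rule lyapunov_eq_real) (rule a(1))
  \<comment> \<open>The constant \<open>c\<close> that was taken out of the objective in
    \<open>N\<close> returns here.\<close>
  define g where "g \<omega> = c + 1 / (2 * \<tau> * \<gamma>) * \<Gamma> (k + 1) \<omega>" for \<omega>
  have "AE \<omega> in M. ereal_cond_exp M F (lyapunov q X h t a \<tau> \<gamma> A \<Gamma> (k + 1)) \<omega>
      = enn2ereal (nn_cond_exp M F N \<omega>) + ereal (real_cond_exp M F g \<omega>)"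
  proof (rule ereal_cond_exp_nonneg_plus_integrable[OF NM])
    show "integrable M g"
      unfolding g_def[abs_def] using \<Gamma> by simp
    fix \<omega>
    have "enn2ereal (N \<omega>) = obj q X h (A (k + 1) \<omega>) + ereal (P' \<omega> - c)"
      unfolding N_def by (rule enn2ereal_e2ennreal[OF nonneg[OF P'0]])
    moreover have "lyapunov q X h t a \<tau> \<gamma> A \<Gamma> (k + 1) \<omega>
        = obj q X h (A (k + 1) \<omega>) + ereal (P' \<omega>) + ereal (1 / (2 * \<tau> * \<gamma>) * \<Gamma> (k + 1) \<omega>)"
      unfolding lyap lyapunov_weight_sum_next[of "lyapunov_weight t a'" "\<lambda>j. A j \<omega>" k t]
      by (simp add: P'_def D_def V_def w_def)
    ultimately show "lyapunov q X h t a \<tau> \<gamma> A \<Gamma> (k + 1) \<omega> = enn2ereal (N \<omega>) + ereal (g \<omega>)"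
      by (cases "obj q X h (A (k + 1) \<omega>)") (auto simp: g_def)
  qed
  moreover have "AE \<omega> in M. real_cond_exp M F g \<omega> = c + 1 / (2 * \<tau> * \<gamma>) * real_cond_exp M F (\<Gamma> (k + 1)) \<omega>"
    unfolding g_def[abs_def] by (rule real_cond_exp_affine[OF \<Gamma>])
  moreover have "AE \<omega> in M. ereal_cond_exp M F (\<lambda>\<omega>. ereal (\<Gamma> (k + 1) \<omega>)) \<omega> = ereal (real_cond_exp M F (\<Gamma> (k + 1)) \<omega>)"
    by (rule ereal_cond_exp_integrable[OF \<Gamma>])
  moreover have "AE \<omega> in M. ereal_cond_exp M F (\<lambda>\<omega>. ereal (e \<omega>)) \<omega> = enn2ereal (nn_cond_exp M F (\<lambda>\<omega>. ennreal (e \<omega>)) \<omega>)"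
    by (rule ereal_cond_exp_nonneg[OF eM]) (simp add: e_def)
  moreover have "AE \<omega> in M. ereal_cond_exp M F (\<lambda>\<omega>. ereal (D \<omega>)) \<omega> = enn2ereal (nn_cond_exp M F (\<lambda>\<omega>. ennreal (D \<omega>)) \<omega>)"
    by (rule ereal_cond_exp_nonneg[OF DM D0])
  ultimately show ?thesis
    using cond finD est1 est2
    unfolding F_def[symmetric] e_def[symmetric] D_def[symmetric] V_def[symmetric]
  proof eventually_elim
    case (elim \<omega>)
    have "Q \<omega> + \<gamma> / 2 * (\<Sum>i=1..t+1. V i \<omega>) \<le> P \<omega> - \<rho> * (\<Sum>i=1..t+1. V i \<omega>)"
      using lyapunov_weight_dissipation[of "\<lambda>i. V i \<omega>" t "a_seq t \<eta> \<alpha> \<beta> L \<gamma> k" a' \<rho> \<gamma>] V0 a_seq a(2) \<rho>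
      by (simp add: Q_def P_def w_def s_def add_diff_eq del: sum.cl_ivl_Suc)
    then have "enn2ereal (nn_cond_exp M F N \<omega>) + ereal (c + 1 / (2 * \<tau> * \<gamma>) * real_cond_exp M F (\<Gamma> (k + 1)) \<omega>)
      \<le> obj q X h (A k \<omega>) + ereal (P \<omega>) + ereal (1 / (2 * \<tau> * \<gamma>) * \<Gamma> k \<omega>)
        - ereal \<rho> * (enn2ereal (nn_cond_exp M F (\<lambda>\<omega>. ennreal (D \<omega>)) \<omega>) + ereal (\<Sum>i=1..t+1. V i \<omega>))"
      using elim(3,4,8,9) unfolding elim(3,4)
      by (intro lyapunov_bound_cond_exp[OF \<tau> \<gamma> \<delta> elim(6) U_def nonneg[OF Q0] _ _ elim(7) _ \<rho>(1)]) simp_all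
    moreover have "lyapunov q X h t a \<tau> \<gamma> A \<Gamma> k \<omega>
        = obj q X h (A k \<omega>) + ereal (P \<omega>) + ereal (1 / (2 * \<tau> * \<gamma>) * \<Gamma> k \<omega>)"
      unfolding lyap by (simp only: P_def V_def w_def)
    ultimately show ?case
      unfolding elim(1,2,5) by simp
  qed
qed

section \<open>Passage from extended real parameters to real constants\<close>

theorem lemma2:
  fixes M :: "'w measure" and Z :: "'z measure"
    and \<xi> :: "nat \<Rightarrow> 'w \<Rightarrow> mode" and \<zeta> :: "nat \<Rightarrow> 'w \<Rightarrow> 'z" and fib :: "'z \<Rightarrow> nat set"
    and q :: "'c::finite \<Rightarrow> 'r::finite"
    and X :: "real ^ 'i3::finite ^ 'i2::finite ^ 'i1::finite"
    and h :: "mode \<Rightarrow> 'r \<Rightarrow> ('c, 'r, 'i1, 'i2, 'i3) factors \<Rightarrow> ereal"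
    and A0 :: "('c, 'r, 'i1, 'i2, 'i3) factors"
    and G A :: "nat \<Rightarrow> 'w \<Rightarrow> ('c, 'r, 'i1, 'i2, 'i3) factors"
    and \<Gamma> \<Upsilon> :: "nat \<Rightarrow> 'w \<Rightarrow> real"
    and \<eta> :: "nat \<Rightarrow> real" and \<alpha> \<beta> :: "int \<Rightarrow> real"
    and L V1 V2 V\<Gamma> \<tau> \<gamma> :: real and \<delta> \<rho> :: ereal
    and a :: "nat \<Rightarrow> ereal" and t B :: nat
  assumes "prob_space M"
    and "surj q"
    and "1 \<le> t"
    and "1 \<le> B" and "\<And>n. B \<le> num_fibers CARD('i1) CARD('i2) CARD('i3) n"
    and "\<And>k. 0 < \<eta> k"
    and "\<And>j. \<alpha> j \<in> {0..1}" and "\<And>j. \<beta> j \<in> {0..1}"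
    and algorithm: "midas_ll1 M Z \<xi> \<zeta> fib B q h t \<eta> \<alpha> A0 G A"
    and regularizers: "\<And>n r. proper_lsc_bdd_convex_on (piece_space q n r) (h n r)"
    and bounded: "\<exists>C. AE \<omega> in M. \<forall>k. norm (A k \<omega>) \<le> C"
    and lipschitz: "AE \<omega> in M. \<forall>k n Y Y'.
        norm (block_grad q X n (replace_block n (A k \<omega>) Y)
            - block_grad q X n (replace_block n (A k \<omega>) Y'))
          \<le> L * norm (block n Y - block n Y')"
    and estimator: "variance_reduced M Z \<xi> \<zeta> q X t \<beta> G A V1 V2 V\<Gamma> \<tau> \<Gamma> \<Upsilon>"
    and "\<gamma> = sqrt (V\<Gamma> / \<tau> + V1)" and "0 < \<gamma>"
    and "a = a_bar t \<eta> \<alpha> \<beta> L \<gamma>"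
    and "\<delta> = b_low t \<eta> \<alpha> L \<gamma> - (\<Sum>j=1..t+1. ereal (real (j + 1)) * a j)"
    and "0 < \<delta>"
    and "0 < ereal (real (t + 2)) * a (t + 1) - ereal (\<gamma> / 2)"
    and "\<rho> = Min {\<delta>, ereal (real (t + 2)) * a (t + 1) - ereal (\<gamma> / 2), Min (a ` {1..t})}"
  shows "\<forall>k. AE \<omega> in M.
    ereal_cond_exp M (history M Z \<xi> \<zeta> k) (lyapunov q X h t a \<tau> \<gamma> A \<Gamma> (k + 1)) \<omega>
    \<le> lyapunov q X h t a \<tau> \<gamma> A \<Gamma> k \<omega>
      - \<rho> * (ereal_cond_exp M (history M Z \<xi> \<zeta> k)
                (\<lambda>\<omega>. ereal ((norm (A (k + 1) \<omega> - A k \<omega>))\<^sup>2)) \<omega>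
             + ereal (\<Sum>i=1..t+1. (norm (A (k + 1 - i) \<omega> - A (k - i) \<omega>))\<^sup>2))"
proof
  fix k
  let ?a = "\<lambda>k i. a_seq t \<eta> \<alpha> \<beta> L \<gamma> k i" and ?b = "b_seq t \<eta> \<alpha> L \<gamma>"
  note \<eta> = assms(6) and \<alpha> = assms(7) and est = assms(13) and \<gamma> = assms(14,15) and a = assms(16)
    and \<delta> = assms(17,18) and last = assms(19) and \<rho> = assms(20)
  interpret M: prob_space M by (rule assms(1))
  \<comment> \<open>An almost sure statement without a sample point is simply true, as the space has
    measure one.\<close>
  have "AE \<omega> in M. 0 \<le> L"
    using lipschitz
  proof eventually_elim
    case (elim \<omega>)
    show ?case
      by (rule block_lipschitz_nonneg[of q X Mode1 "A 0 \<omega>"]) (use elim in blast)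
  qed
  then have L: "0 \<le> L"
    by simp
  have \<alpha>0: "0 \<le> \<alpha> j" for j
    using \<alpha>[of j] by simp
  have a_pos: "0 \<le> ?a k i" for k i
    unfolding a_seq_def using L \<alpha>0 \<eta>[of k] \<gamma>(2) by (simp add: less_imp_le)
  have a_ge: "ereal (?a k i) \<le> a i" for k i
    unfolding a a_bar_def by (rule SUP_upper) simp
  have b_le: "b_low t \<eta> \<alpha> L \<gamma> \<le> ereal (?b k)" for k
    unfolding b_low_def by (rule INF_lower) simp
  \<comment> \<open>\<open>b_low\<close> lies below the real number \<open>b_seq\<close> at
    \<open>0\<close>, so an infinite weighted sum would make \<open>\<delta>\<close> equal to
    \<open>-\<infinity>\<close>.\<close>
  have a_fin: "a j \<noteq> \<infinity>" if "j \<in> {1..t+1}" for j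
  proof
    assume "a j = \<infinity>"
    then have "(\<Sum>j=1..t+1. ereal (real (j + 1)) * a j) = \<infinity>"
      unfolding sum_Pinfty using that by (intro conjI bexI[of _ j]) auto
    then show False
      using \<delta> b_le[of 0] by (cases "b_low t \<eta> \<alpha> L \<gamma>") auto
  qed
  define a' where "a' j = real_of_ereal (a j)" for j
  have a': "a j = ereal (a' j)" if "j \<in> {1..t+1}" for j
    using a_fin[OF that] a_ge[of 0 j] unfolding a'_def by (cases "a j") auto
  have a'_ge: "?a k i \<le> a' i" if "i \<in> {1..t+1}" for k i
    using a_ge[of k i] a'[OF that] by simp
  have a'0: "0 \<le> a' i" if "i \<in> {1..t+1}" for i
    using a'_ge[OF that, of 0] a_pos[of 0 i] by simp
  have "(\<Sum>j=1..t+1. ereal (real (j + 1)) * a j) = (\<Sum>j=1..t+1. ereal (real (j + 1) * a' j))"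
    using a' by (intro sum.cong) auto
  then have sum: "(\<Sum>j=1..t+1. ereal (real (j + 1)) * a j) = ereal (lyapunov_weight t a' 1)"
    by (simp only: lyapunov_weight_def sum_ereal)
  \<comment> \<open>Positivity of \<open>\<delta>\<close> also excludes \<open>-\<infinity>\<close>
    for \<open>b_low\<close>; hence \<open>\<delta>\<close> is real, and the bound passes from
    \<open>b_low\<close> to the current iteration.\<close>
  obtain d where d: "\<delta> = ereal d" "0 < d" "lyapunov_weight t a' 1 + d \<le> ?b k"
    using \<delta> b_le[of k] unfolding sum by (cases "b_low t \<eta> \<alpha> L \<gamma>") auto
  have last': "ereal (real (t + 2)) * a (t + 1) - ereal (\<gamma> / 2) = ereal (real (t + 2) * a' (t + 1) - \<gamma> / 2)"
    using a'[of "t + 1"] by simp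
  have "a ` {1..t} = ereal ` a' ` {1..t}"
    unfolding image_image using a' by (intro image_cong) auto
  \<comment> \<open>The monotone map \<open>ereal\<close> commutes with this minimum, whose index
    set is nonempty by \<open>1 \<le> t\<close>.\<close>
  moreover have "Min (ereal ` a' ` {1..t}) = ereal (Min (a' ` {1..t}))"
    using assms(3) by (intro mono_Min_commute[symmetric] monoI) auto
  ultimately have Min_a: "Min (a ` {1..t}) = ereal (Min (a' ` {1..t}))" by simp
  define r where "r = min d (min (real (t + 2) * a' (t + 1) - \<gamma> / 2) (Min (a' ` {1..t})))"
  have r: "\<rho> = ereal r"
    unfolding \<rho> last' Min_a d(1) r_def by (simp add: min_def)
  \<comment> \<open>All three facts carry the premise on \<open>i\<close>; the first two are later
    used with \<open>i = 1\<close>, which \<open>1 \<le> t\<close> admits.\<close>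
  have r_le: "r \<le> d" "r \<le> real (t + 2) * a' (t + 1) - \<gamma> / 2" "r \<le> a' i" if "i \<in> {1..t}" for i
  proof -
    have "Min (a' ` {1..t}) \<le> a' i"
      using that by (intro Min_le) auto
    then show "r \<le> a' i" by (simp add: r_def)
  qed (simp_all add: r_def)
  have \<gamma>2: "\<gamma>\<^sup>2 = V\<Gamma> / \<tau> + V1"
    using est unfolding \<gamma>(1) variance_reduced_def by simp
  obtain C where C: "AE \<omega> in M. \<forall>k. norm (A k \<omega>) \<le> C"
    using bounded by blast
  show "AE \<omega> in M.
    ereal_cond_exp M (history M Z \<xi> \<zeta> k) (lyapunov q X h t a \<tau> \<gamma> A \<Gamma> (k + 1)) \<omega>
    \<le> lyapunov q X h t a \<tau> \<gamma> A \<Gamma> k \<omega>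
      - \<rho> * (ereal_cond_exp M (history M Z \<xi> \<zeta> k)
                (\<lambda>\<omega>. ereal ((norm (A (k + 1) \<omega> - A k \<omega>))\<^sup>2)) \<omega>
             + ereal (\<Sum>i=1..t+1. (norm (A (k + 1 - i) \<omega> - A (k - i) \<omega>))\<^sup>2))"
    unfolding r
    by (rule expected_lyapunov_descent[where a' = a' and \<delta> = d and C = C,
          OF assms(1) \<eta> \<alpha>0 algorithm regularizers C lipschitz est \<gamma>(2) \<gamma>2 L])
      (use a' a'0 a'_ge d r_le r_le(1,2)[of 1] assms(3) in auto)
qed

end
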